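(* Let $k$ be a field, $H$ a Hopf algebra over $k$, and $C$ a left $H$-module coalgebra over $k$. Then the map $$\mathrm{coId}_l(H)\to\mathrm{Quot}(C/C^H),\qquad I\mapsto C/(I+k1_H)^+C$$ is part of a Galois connection between $\mathrm{Quot}(C/C^H)$ and $\mathrm{coId}_l(H)$; i.e. there is a map $\mathrm{Quot}(C/C^H)\to\mathrm{coId}_l(H)$ which forms a Galois connection with it.
   Context: A left $H$-module coalgebra is a coalgebra $C$ which is a left $H$-module such that $\Delta_C(h\cdot c)=\Delta_H(h)\Delta_C(c)$ and $\epsilon_C(h\cdot c)=\epsilon_H(h)\epsilon_C(c)$. For a subspace $V\subseteq H$, $V^+=V\cap\ker\epsilon_H$, and $V^+C$ is the span of all $v\cdot c$, $v\in V^+$, $c\in C$. $C^H=C/H^+C$. $\mathrm{coId}_l(H)$ is the poset (under inclusion) of left coideals of $H$, i.e. subspaces $I\subseteq H$ with $\Delta(I)\subseteq H\otimes I$. $\mathrm{Quot}(C)$ is the set of quotient coalgebras $C/J$, $J$ a coideal of $C$, ordered by $C/J_1\succcurlyeq C/J_2\Leftrightarrow J_1\subseteq J_2$, and $\mathrm{Quot}(C/C^H)=\{Q\in\mathrm{Quot}(C):C\succcurlyeq Q\succcurlyeq C^H\}$. A Galois connection between posets $P$ and $P'$ is a pair of order-reversing maps $f:P\to P'$, $g:P'\to P$ with $p\le g(f(p))$ and $p'\le f(g(p'))$ for all $p\in P$, $p'\in P'$. *)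

theory Defs
  imports "HOL-Algebra.Module" "HOL-Algebra.AbelCoset" "HOL-Algebra.Order"
begin

section \<open>Linear algebra over a field, in terms of HOL-Algebra modules\<close>

definition linear_map ::
  "('k, 'm) ring_scheme \<Rightarrow> ('k, 'v, 'n) module_scheme \<Rightarrow> ('k, 'w, 'p) module_scheme \<Rightarrow> ('v \<Rightarrow> 'w) \<Rightarrow> bool"
  where "linear_map K V W f \<longleftrightarrow>
    f \<in> carrier V \<rightarrow> carrier W \<and>
    (\<forall>x\<in>carrier V. \<forall>y\<in>carrier V. f (x \<oplus>\<^bsub>V\<^esub> y) = f x \<oplus>\<^bsub>W\<^esub> f y) \<and>
    (\<forall>a\<in>carrier K. \<forall>x\<in>carrier V. f (a \<odot>\<^bsub>V\<^esub> x) = a \<odot>\<^bsub>W\<^esub> f x)"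

definition linear_form ::
  "('k, 'm) ring_scheme \<Rightarrow> ('k, 'v, 'n) module_scheme \<Rightarrow> ('v \<Rightarrow> 'k) \<Rightarrow> bool"
  where "linear_form K V f \<longleftrightarrow>
    f \<in> carrier V \<rightarrow> carrier K \<and>
    (\<forall>x\<in>carrier V. \<forall>y\<in>carrier V. f (x \<oplus>\<^bsub>V\<^esub> y) = f x \<oplus>\<^bsub>K\<^esub> f y) \<and>
    (\<forall>a\<in>carrier K. \<forall>x\<in>carrier V. f (a \<odot>\<^bsub>V\<^esub> x) = a \<otimes>\<^bsub>K\<^esub> f x)"

definition lin_span ::
  "('k, 'm) ring_scheme \<Rightarrow> ('k, 'v, 'n) module_scheme \<Rightarrow> 'v set \<Rightarrow> 'v set"
  where "lin_span K V S = \<Inter>{U. submodule U K V \<and> S \<subseteq> U}"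

text \<open>The components \<open>mult\<close> and \<open>one\<close>, which every module record inherits from the ring record,
  carry no information for a mere vector space; in the spaces constructed below they are
  left undefined.\<close>

definition quotient_space :: "('k, 'v, 'n) module_scheme \<Rightarrow> 'v set \<Rightarrow> ('k, 'v set) module"
  where "quotient_space V U =
    \<lparr> carrier = a_rcosets\<^bsub>V\<^esub> U,
      monoid.mult = (\<lambda>_ _. undefined), one = undefined,
      zero = U,
      add = set_add V,
      smult = (\<lambda>a X. \<Union>x\<in>X. U +>\<^bsub>V\<^esub> (a \<odot>\<^bsub>V\<^esub> x)) \<rparr>"


section \<open>Tensor products\<close>

text \<open>A list \<open>[(v\<^sub>1, w\<^sub>1), \<dots>, (v\<^sub>n, w\<^sub>n)]\<close> stands for the formal sum of the \<open>v\<^sub>i \<otimes> w\<^sub>i\<close>, and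
  the tensor product is the set of classes of such sums under the congruence (for
  concatenation) generated by the following relations.  Modulo this congruence
  \<open>(\<ominus> v, w)\<close> is inverse to \<open>(v, w)\<close>, so that this is the usual presentation of the
  tensor product by generators and relations.\<close>

inductive tensor_cong ::
  "('k, 'm) ring_scheme \<Rightarrow> ('k, 'v, 'n) module_scheme \<Rightarrow> ('k, 'w, 'p) module_scheme \<Rightarrow>
    ('v \<times> 'w) list \<Rightarrow> ('v \<times> 'w) list \<Rightarrow> bool"
  for K V W
  where
    refl: "set x \<subseteq> carrier V \<times> carrier W \<Longrightarrow> tensor_cong K V W x x"
  | sym: "tensor_cong K V W x y \<Longrightarrow> tensor_cong K V W y x"
  | trans: "tensor_cong K V W x y \<Longrightarrow> tensor_cong K V W y z \<Longrightarrow> tensor_cong K V W x z"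
  | append: "tensor_cong K V W x y \<Longrightarrow> tensor_cong K V W x' y' \<Longrightarrow>
      tensor_cong K V W (x @ x') (y @ y')"
  | comm: "set x \<subseteq> carrier V \<times> carrier W \<Longrightarrow> set y \<subseteq> carrier V \<times> carrier W \<Longrightarrow>
      tensor_cong K V W (x @ y) (y @ x)"
  | add_left: "v \<in> carrier V \<Longrightarrow> v' \<in> carrier V \<Longrightarrow> w \<in> carrier W \<Longrightarrow>
      tensor_cong K V W [(v \<oplus>\<^bsub>V\<^esub> v', w)] [(v, w), (v', w)]"
  | add_right: "v \<in> carrier V \<Longrightarrow> w \<in> carrier W \<Longrightarrow> w' \<in> carrier W \<Longrightarrow>
      tensor_cong K V W [(v, w \<oplus>\<^bsub>W\<^esub> w')] [(v, w), (v, w')]"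
  | smult: "a \<in> carrier K \<Longrightarrow> v \<in> carrier V \<Longrightarrow> w \<in> carrier W \<Longrightarrow>
      tensor_cong K V W [(a \<odot>\<^bsub>V\<^esub> v, w)] [(v, a \<odot>\<^bsub>W\<^esub> w)]"
  | zero: "w \<in> carrier W \<Longrightarrow> tensor_cong K V W [(\<zero>\<^bsub>V\<^esub>, w)] []"

definition tensor_class ::
  "('k, 'm) ring_scheme \<Rightarrow> ('k, 'v, 'n) module_scheme \<Rightarrow> ('k, 'w, 'p) module_scheme \<Rightarrow>
    ('v \<times> 'w) list \<Rightarrow> ('v \<times> 'w) list set"
  where "tensor_class K V W x = {y. tensor_cong K V W x y}"

definition tensor ::
  "('k, 'm) ring_scheme \<Rightarrow> ('k, 'v, 'n) module_scheme \<Rightarrow> ('k, 'w, 'p) module_scheme \<Rightarrow>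
    ('k, ('v \<times> 'w) list set) module"
  where "tensor K V W =
    \<lparr> carrier = tensor_class K V W ` lists (carrier V \<times> carrier W),
      monoid.mult = (\<lambda>_ _. undefined), one = undefined,
      zero = tensor_class K V W [],
      add = (\<lambda>X Y. \<Union>x\<in>X. \<Union>y\<in>Y. tensor_class K V W (x @ y)),
      smult = (\<lambda>a X. \<Union>x\<in>X. tensor_class K V W (map (\<lambda>(v, w). (a \<odot>\<^bsub>V\<^esub> v, w)) x)) \<rparr>"

definition pure_tensor ::
  "('k, 'm) ring_scheme \<Rightarrow> ('k, 'v, 'n) module_scheme \<Rightarrow> ('k, 'w, 'p) module_scheme \<Rightarrow>
    'v \<Rightarrow> 'w \<Rightarrow> ('v \<times> 'w) list set"
  where "pure_tensor K V W v w = tensor_class K V W [(v, w)]"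

text \<open>The linear map \<open>v \<otimes> w \<mapsto> \<beta> v w\<close> induced by a bilinear map \<open>\<beta>\<close> into \<open>N\<close>: evaluate any
  formal sum representing \<open>X\<close>.  For bilinear \<open>\<beta>\<close> the value does not depend on the
  representative, so the image below is a singleton.\<close>

definition tensor_lift ::
  "('k, 'u, 'n) module_scheme \<Rightarrow> ('v \<Rightarrow> 'w \<Rightarrow> 'u) \<Rightarrow> ('v \<times> 'w) list set \<Rightarrow> 'u"
  where "tensor_lift N \<beta> X =
    the_elem ((\<lambda>x. foldr (\<lambda>(v, w) n. \<beta> v w \<oplus>\<^bsub>N\<^esub> n) x \<zero>\<^bsub>N\<^esub>) ` X)"

text \<open>The map \<open>f \<otimes> g\<close> into the tensor product of \<open>V'\<close> and \<open>W'\<close>.\<close>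

definition tensor_map ::
  "('k, 'm) ring_scheme \<Rightarrow> ('k, 'v2, 'n) module_scheme \<Rightarrow> ('k, 'w2, 'p) module_scheme \<Rightarrow>
    ('v \<Rightarrow> 'v2) \<Rightarrow> ('w \<Rightarrow> 'w2) \<Rightarrow> ('v \<times> 'w) list set \<Rightarrow> ('v2 \<times> 'w2) list set"
  where "tensor_map K V' W' f g =
    tensor_lift (tensor K V' W') (\<lambda>v w. pure_tensor K V' W' (f v) (g w))"

text \<open>For a bilinear map \<open>\<mu> : A \<times> V \<rightarrow> V\<close>, the bilinear map
  \<open>(A \<otimes> A) \<times> (V \<otimes> V) \<rightarrow> V \<otimes> V\<close> with \<open>(a \<otimes> b) (v \<otimes> w) = \<mu> a v \<otimes> \<mu> b w\<close>.\<close>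

definition tensor_act ::
  "('k, 'm) ring_scheme \<Rightarrow> ('k, 'v, 'n) module_scheme \<Rightarrow> ('a \<Rightarrow> 'v \<Rightarrow> 'v) \<Rightarrow>
    ('a \<times> 'a) list set \<Rightarrow> ('v \<times> 'v) list set \<Rightarrow> ('v \<times> 'v) list set"
  where "tensor_act K V \<mu> X Y =
    tensor_lift (tensor K V V) (\<lambda>a b.
      tensor_lift (tensor K V V) (\<lambda>v w. pure_tensor K V V (\<mu> a v) (\<mu> b w)) Y) X"

text \<open>The isomorphism \<open>(V \<otimes> V) \<otimes> V \<rightarrow> V \<otimes> (V \<otimes> V)\<close>.\<close>

definition tensor_assoc ::
  "('k, 'm) ring_scheme \<Rightarrow> ('k, 'v, 'n) module_scheme \<Rightarrow>
    (('v \<times> 'v) list set \<times> 'v) list set \<Rightarrow> ('v \<times> ('v \<times> 'v) list set) list set"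
  where "tensor_assoc K V =
    tensor_lift (tensor K V (tensor K V V)) (\<lambda>X w.
      tensor_lift (tensor K V (tensor K V V)) (\<lambda>u v.
        pure_tensor K V (tensor K V V) u (pure_tensor K V V v w)) X)"

text \<open>For subspaces \<open>A\<close> of \<open>V\<close> and \<open>B\<close> of \<open>W\<close>, the subspace \<open>A \<otimes> B\<close> of \<open>V \<otimes> W\<close>.\<close>

definition tensor_subspace ::
  "('k, 'm) ring_scheme \<Rightarrow> ('k, 'v, 'n) module_scheme \<Rightarrow> ('k, 'w, 'p) module_scheme \<Rightarrow>
    'v set \<Rightarrow> 'w set \<Rightarrow> ('v \<times> 'w) list set set"
  where "tensor_subspace K V W A B =
    lin_span K (tensor K V W) {pure_tensor K V W a b |a b. a \<in> A \<and> b \<in> B}"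


section \<open>Coalgebras and Hopf algebras\<close>

record ('k, 'v) coalgebra = "('k, 'v) module" +
  comult :: "'v \<Rightarrow> ('v \<times> 'v) list set"
  counit :: "'v \<Rightarrow> 'k"

text \<open>The counit laws are stated after identifying \<open>k \<otimes> C\<close> and \<open>C \<otimes> k\<close> with \<open>C\<close>.\<close>

definition is_coalgebra :: "('k, 'm) ring_scheme \<Rightarrow> ('k, 'c, 'n) coalgebra_scheme \<Rightarrow> bool"
  where "is_coalgebra K C \<longleftrightarrow>
    module K C \<and>
    linear_map K C (tensor K C C) (comult C) \<and>
    linear_form K C (counit C) \<and>
    (\<forall>c\<in>carrier C.
      tensor_assoc K C (tensor_map K (tensor K C C) C (comult C) (\<lambda>x. x) (comult C c)) =
      tensor_map K C (tensor K C C) (\<lambda>x. x) (comult C) (comult C c)) \<and>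
    (\<forall>c\<in>carrier C. tensor_lift C (\<lambda>x y. counit C x \<odot>\<^bsub>C\<^esub> y) (comult C c) = c) \<and>
    (\<forall>c\<in>carrier C. tensor_lift C (\<lambda>x y. counit C y \<odot>\<^bsub>C\<^esub> x) (comult C c) = c)"

text \<open>The locale \<open>algebra\<close> of HOL-Algebra requires commutativity.\<close>

definition unital_algebra :: "('k, 'm) ring_scheme \<Rightarrow> ('k, 'a, 'n) module_scheme \<Rightarrow> bool"
  where "unital_algebra K A \<longleftrightarrow>
    module K A \<and> ring A \<and>
    (\<forall>r\<in>carrier K. \<forall>x\<in>carrier A. \<forall>y\<in>carrier A.
      (r \<odot>\<^bsub>A\<^esub> x) \<otimes>\<^bsub>A\<^esub> y = r \<odot>\<^bsub>A\<^esub> (x \<otimes>\<^bsub>A\<^esub> y) \<and>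
      x \<otimes>\<^bsub>A\<^esub> (r \<odot>\<^bsub>A\<^esub> y) = r \<odot>\<^bsub>A\<^esub> (x \<otimes>\<^bsub>A\<^esub> y))"

definition bialgebra :: "('k, 'm) ring_scheme \<Rightarrow> ('k, 'h, 'n) coalgebra_scheme \<Rightarrow> bool"
  where "bialgebra K H \<longleftrightarrow>
    unital_algebra K H \<and> is_coalgebra K H \<and>
    comult H \<one>\<^bsub>H\<^esub> = pure_tensor K H H \<one>\<^bsub>H\<^esub> \<one>\<^bsub>H\<^esub> \<and>
    (\<forall>x\<in>carrier H. \<forall>y\<in>carrier H.
      comult H (x \<otimes>\<^bsub>H\<^esub> y) = tensor_act K H (mult H) (comult H x) (comult H y)) \<and>
    counit H \<one>\<^bsub>H\<^esub> = \<one>\<^bsub>K\<^esub> \<and>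
    (\<forall>x\<in>carrier H. \<forall>y\<in>carrier H. counit H (x \<otimes>\<^bsub>H\<^esub> y) = counit H x \<otimes>\<^bsub>K\<^esub> counit H y)"

definition antipode ::
  "('k, 'm) ring_scheme \<Rightarrow> ('k, 'h, 'n) coalgebra_scheme \<Rightarrow> ('h \<Rightarrow> 'h) \<Rightarrow> bool"
  where "antipode K H S \<longleftrightarrow>
    linear_map K H H S \<and>
    (\<forall>h\<in>carrier H. tensor_lift H (\<lambda>x y. S x \<otimes>\<^bsub>H\<^esub> y) (comult H h) = counit H h \<odot>\<^bsub>H\<^esub> \<one>\<^bsub>H\<^esub>) \<and>
    (\<forall>h\<in>carrier H. tensor_lift H (\<lambda>x y. x \<otimes>\<^bsub>H\<^esub> S y) (comult H h) = counit H h \<odot>\<^bsub>H\<^esub> \<one>\<^bsub>H\<^esub>)"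

definition hopf_algebra :: "('k, 'm) ring_scheme \<Rightarrow> ('k, 'h, 'n) coalgebra_scheme \<Rightarrow> bool"
  where "hopf_algebra K H \<longleftrightarrow> bialgebra K H \<and> (\<exists>S. antipode K H S)"


section \<open>Module coalgebras\<close>

definition left_module ::
  "('k, 'm) ring_scheme \<Rightarrow> ('k, 'h, 'n) module_scheme \<Rightarrow> ('k, 'c, 'p) module_scheme \<Rightarrow>
    ('h \<Rightarrow> 'c \<Rightarrow> 'c) \<Rightarrow> bool"
  where "left_module K H C act \<longleftrightarrow>
    module K C \<and>
    (\<forall>h\<in>carrier H. linear_map K C C (act h)) \<and>
    (\<forall>c\<in>carrier C. linear_map K H C (\<lambda>h. act h c)) \<and>
    (\<forall>g\<in>carrier H. \<forall>h\<in>carrier H. \<forall>c\<in>carrier C. act (g \<otimes>\<^bsub>H\<^esub> h) c = act g (act h c)) \<and>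
    (\<forall>c\<in>carrier C. act \<one>\<^bsub>H\<^esub> c = c)"

definition left_module_coalgebra ::
  "('k, 'm) ring_scheme \<Rightarrow> ('k, 'h, 'n) coalgebra_scheme \<Rightarrow> ('k, 'c, 'p) coalgebra_scheme \<Rightarrow>
    ('h \<Rightarrow> 'c \<Rightarrow> 'c) \<Rightarrow> bool"
  where "left_module_coalgebra K H C act \<longleftrightarrow>
    is_coalgebra K C \<and> left_module K H C act \<and>
    (\<forall>h\<in>carrier H. \<forall>c\<in>carrier C.
      comult C (act h c) = tensor_act K C act (comult H h) (comult C c) \<and>
      counit C (act h c) = counit H h \<otimes>\<^bsub>K\<^esub> counit C c)"

definition augmentation_part ::
  "('k, 'm) ring_scheme \<Rightarrow> ('k, 'h, 'n) coalgebra_scheme \<Rightarrow> 'h set \<Rightarrow> 'h set"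
  where "augmentation_part K H V = {v \<in> V. counit H v = \<zero>\<^bsub>K\<^esub>}"

definition action_span ::
  "('k, 'm) ring_scheme \<Rightarrow> ('k, 'c, 'n) module_scheme \<Rightarrow> ('h \<Rightarrow> 'c \<Rightarrow> 'c) \<Rightarrow> 'h set \<Rightarrow> 'c set"
  where "action_span K C act V = lin_span K C {act v c |v c. v \<in> V \<and> c \<in> carrier C}"

definition plus_scalars ::
  "('k, 'm) ring_scheme \<Rightarrow> ('k, 'h, 'n) module_scheme \<Rightarrow> 'h set \<Rightarrow> 'h set"
  where "plus_scalars K H I = I <+>\<^bsub>H\<^esub> {a \<odot>\<^bsub>H\<^esub> \<one>\<^bsub>H\<^esub> |a. a \<in> carrier K}"


section \<open>Left coideals and quotient coalgebras\<close>

definition left_coideal ::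
  "('k, 'm) ring_scheme \<Rightarrow> ('k, 'h, 'n) coalgebra_scheme \<Rightarrow> 'h set \<Rightarrow> bool"
  where "left_coideal K H I \<longleftrightarrow>
    submodule I K H \<and> comult H ` I \<subseteq> tensor_subspace K H H (carrier H) I"

definition coideal ::
  "('k, 'm) ring_scheme \<Rightarrow> ('k, 'c, 'n) coalgebra_scheme \<Rightarrow> 'c set \<Rightarrow> bool"
  where "coideal K C J \<longleftrightarrow>
    submodule J K C \<and>
    comult C ` J \<subseteq> tensor_subspace K C C J (carrier C) <+>\<^bsub>tensor K C C\<^esub>
                   tensor_subspace K C C (carrier C) J \<and>
    (\<forall>x\<in>J. counit C x = \<zero>\<^bsub>K\<^esub>)"

text \<open>\<open>C/J\<close>, with the structure maps induced by those of \<open>C\<close> on representatives; for a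
  coideal \<open>J\<close> they do not depend on the representative.\<close>

definition quotient_coalgebra ::
  "('k, 'm) ring_scheme \<Rightarrow> ('k, 'c, 'n) coalgebra_scheme \<Rightarrow> 'c set \<Rightarrow> ('k, 'c set) coalgebra"
  where "quotient_coalgebra K C J =
    module.extend (quotient_space C J)
      (coalgebra.fields
        (\<lambda>X. the_elem ((\<lambda>x. tensor_map K (quotient_space C J) (quotient_space C J)
          (\<lambda>y. J +>\<^bsub>C\<^esub> y) (\<lambda>y. J +>\<^bsub>C\<^esub> y) (comult C x)) ` X))
        (\<lambda>X. the_elem (counit C ` X)))"

definition Quot ::
  "('k, 'm) ring_scheme \<Rightarrow> ('k, 'c, 'n) coalgebra_scheme \<Rightarrow> ('k, 'c set) coalgebra set"
  where "Quot K C = {quotient_coalgebra K C J |J. coideal K C J}"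

definition quot_ge ::
  "('k, 'm) ring_scheme \<Rightarrow> ('k, 'c, 'n) coalgebra_scheme \<Rightarrow>
    ('k, 'c set) coalgebra \<Rightarrow> ('k, 'c set) coalgebra \<Rightarrow> bool"
  where "quot_ge K C Q1 Q2 \<longleftrightarrow>
    (\<exists>J1 J2. coideal K C J1 \<and> coideal K C J2 \<and>
      Q1 = quotient_coalgebra K C J1 \<and> Q2 = quotient_coalgebra K C J2 \<and> J1 \<subseteq> J2)"

definition coinvariant_quotient ::
  "('k, 'm) ring_scheme \<Rightarrow> ('k, 'h, 'n) coalgebra_scheme \<Rightarrow> ('k, 'c, 'p) coalgebra_scheme \<Rightarrow>
    ('h \<Rightarrow> 'c \<Rightarrow> 'c) \<Rightarrow> ('k, 'c set) coalgebra"
  where "coinvariant_quotient K H C act =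
    quotient_coalgebra K C (action_span K C act (augmentation_part K H (carrier H)))"

text \<open>As an element of \<open>Quot K C\<close>, the coalgebra \<open>C\<close> itself is the quotient by the zero
  coideal.\<close>

definition Quot_poset ::
  "('k, 'm) ring_scheme \<Rightarrow> ('k, 'h, 'n) coalgebra_scheme \<Rightarrow> ('k, 'c, 'p) coalgebra_scheme \<Rightarrow>
    ('h \<Rightarrow> 'c \<Rightarrow> 'c) \<Rightarrow> ('k, 'c set) coalgebra gorder"
  where "Quot_poset K H C act =
    \<lparr> carrier = {Q \<in> Quot K C.
        quot_ge K C (quotient_coalgebra K C {\<zero>\<^bsub>C\<^esub>}) Q \<and>
        quot_ge K C Q (coinvariant_quotient K H C act)},
      eq = (=),
      le = (\<lambda>Q1 Q2. quot_ge K C Q2 Q1) \<rparr>"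

definition coId_poset ::
  "('k, 'm) ring_scheme \<Rightarrow> ('k, 'h, 'n) coalgebra_scheme \<Rightarrow> 'h set gorder"
  where "coId_poset K H = \<lparr> carrier = {I. left_coideal K H I}, eq = (=), le = (\<subseteq>) \<rparr>"

definition coideal_quotient ::
  "('k, 'm) ring_scheme \<Rightarrow> ('k, 'h, 'n) coalgebra_scheme \<Rightarrow> ('k, 'c, 'p) coalgebra_scheme \<Rightarrow>
    ('h \<Rightarrow> 'c \<Rightarrow> 'c) \<Rightarrow> 'h set \<Rightarrow> ('k, 'c set) coalgebra"
  where "coideal_quotient K H C act I =
    quotient_coalgebra K C
      (action_span K C act (augmentation_part K H (plus_scalars K H I)))"


section \<open>Order-reversing Galois connections\<close>

text \<open>The locale \<open>galois_connection\<close> of HOL-Algebra is the order-preserving variant.\<close>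

definition antitone_galois_connection ::
  "('p, 'm) gorder_scheme \<Rightarrow> ('q, 'n) gorder_scheme \<Rightarrow> ('p \<Rightarrow> 'q) \<Rightarrow> ('q \<Rightarrow> 'p) \<Rightarrow> bool"
  where "antitone_galois_connection P P' f g \<longleftrightarrow>
    partial_order P \<and> partial_order P' \<and>
    f \<in> carrier P \<rightarrow> carrier P' \<and> g \<in> carrier P' \<rightarrow> carrier P \<and>
    (\<forall>p\<in>carrier P. \<forall>q\<in>carrier P. p \<sqsubseteq>\<^bsub>P\<^esub> q \<longrightarrow> f q \<sqsubseteq>\<^bsub>P'\<^esub> f p) \<and>
    (\<forall>p\<in>carrier P'. \<forall>q\<in>carrier P'. p \<sqsubseteq>\<^bsub>P'\<^esub> q \<longrightarrow> g q \<sqsubseteq>\<^bsub>P\<^esub> g p) \<and>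
    (\<forall>p\<in>carrier P. p \<sqsubseteq>\<^bsub>P\<^esub> g (f p)) \<and>
    (\<forall>p\<in>carrier P'. p \<sqsubseteq>\<^bsub>P'\<^esub> f (g p))"

end

theory Submission
  imports Defs
begin

text \<open>
  Write \<open>J I = (I + k1)\<^sup>+ C\<close> for a left coideal \<open>I\<close> of \<open>H\<close>.  An element \<open>x + a 1\<close> of
  \<open>I + k1\<close> is killed by the counit exactly when \<open>a = - \<epsilon> x\<close>, so \<open>(I + k1)\<^sup>+\<close> consists
  of the elements \<open>x - \<epsilon>(x) 1\<close> with \<open>x \<in> I\<close>.  These depend linearly on \<open>x\<close>, and hence
  \<open>J\<close> is monotone and turns sums of left coideals into sums of subspaces.  A sum of left
  coideals is again a left coideal, so for every coideal \<open>J'\<close> of \<open>C\<close> there is a largest left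
  coideal \<open>I\<close> with \<open>J I \<subseteq> J'\<close>, and sending \<open>C/J'\<close> to it is the required adjoint
  (\<open>galois_connection_coideal_quotient\<close>).  The map is well defined on quotients because the zero
  element of \<open>C/J'\<close> is the coset \<open>J'\<close> itself.

  What has to be proved is that \<open>J I\<close> is a coideal of \<open>C\<close>
  (\<open>coideal_generated_coideal\<close>).  For \<open>x \<in> I\<close> the coideal property gives
  \<open>\<Delta> x = \<Sum> h\<^sub>i \<otimes> x\<^sub>i\<close> with \<open>x\<^sub>i \<in> I\<close>.  Splitting \<open>x\<^sub>i\<close> as
  \<open>(x\<^sub>i - \<epsilon>(x\<^sub>i) 1) + \<epsilon>(x\<^sub>i) 1\<close> and collecting the second summands by the
  counit law, \<open>\<Delta> x = \<Sum> h\<^sub>i \<otimes> (x\<^sub>i - \<epsilon>(x\<^sub>i) 1) + x \<otimes> 1\<close>.  Applied to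
  \<open>\<Delta> c\<close>, the sum lands in \<open>C \<otimes> J I\<close> (\<open>tensor_act_mod_right\<close>), and
  \<open>x \<otimes> 1 - \<epsilon>(x) 1 \<otimes> 1\<close> lands in \<open>J I \<otimes> C\<close>; together they make up
  \<open>\<Delta> ((x - \<epsilon>(x) 1) c)\<close>.

  Every statement about elements of a tensor product is reduced to pure tensors: the set of
  elements at which a linear map has its value in a given subspace is itself a subspace, and pure
  tensors span.
\<close>


section \<open>Linear maps, submodules and spans\<close>

lemma linear_mapI:
  assumes "\<And>x. x \<in> carrier V \<Longrightarrow> f x \<in> carrier W"
    and "\<And>x y. x \<in> carrier V \<Longrightarrow> y \<in> carrier V \<Longrightarrow> f (x \<oplus>\<^bsub>V\<^esub> y) = f x \<oplus>\<^bsub>W\<^esub> f y"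
    and "\<And>a x. a \<in> carrier K \<Longrightarrow> x \<in> carrier V \<Longrightarrow> f (a \<odot>\<^bsub>V\<^esub> x) = a \<odot>\<^bsub>W\<^esub> f x"
  shows "linear_map K V W f"
  using assms by (auto simp: linear_map_def)

lemma linear_mapD:
  assumes "linear_map K V W f"
  shows linear_map_closed: "\<And>x. x \<in> carrier V \<Longrightarrow> f x \<in> carrier W"
    and linear_map_add:
      "\<And>x y. x \<in> carrier V \<Longrightarrow> y \<in> carrier V \<Longrightarrow> f (x \<oplus>\<^bsub>V\<^esub> y) = f x \<oplus>\<^bsub>W\<^esub> f y"
    and linear_map_smult:
      "\<And>a x. a \<in> carrier K \<Longrightarrow> x \<in> carrier V \<Longrightarrow> f (a \<odot>\<^bsub>V\<^esub> x) = a \<odot>\<^bsub>W\<^esub> f x"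
  using assms by (auto simp: linear_map_def)

lemma linear_map_zero:
  assumes "module K V" "module K W" "linear_map K V W f"
  shows "f \<zero>\<^bsub>V\<^esub> = \<zero>\<^bsub>W\<^esub>"
proof -
  interpret V: module K V by fact
  interpret W: module K W by fact
  have "f (\<zero>\<^bsub>K\<^esub> \<odot>\<^bsub>V\<^esub> \<zero>\<^bsub>V\<^esub>) = \<zero>\<^bsub>K\<^esub> \<odot>\<^bsub>W\<^esub> f \<zero>\<^bsub>V\<^esub>"
    by (rule linear_map_smult[OF assms(3)]) auto
  then show ?thesis using linear_map_closed[OF assms(3)] by simp
qed

lemma linear_map_minus:
  assumes "module K V" "module K W" "linear_map K V W f" "x \<in> carrier V"
  shows "f (\<ominus>\<^bsub>V\<^esub> x) = \<ominus>\<^bsub>W\<^esub> f x"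
proof -
  interpret V: module K V by fact
  interpret W: module K W by fact
  have "f ((\<ominus>\<^bsub>K\<^esub> \<one>\<^bsub>K\<^esub>) \<odot>\<^bsub>V\<^esub> x) = (\<ominus>\<^bsub>K\<^esub> \<one>\<^bsub>K\<^esub>) \<odot>\<^bsub>W\<^esub> f x"
    by (rule linear_map_smult[OF assms(3)]) (simp_all add: assms(4))
  moreover have "f x \<in> carrier W" by (rule linear_map_closed[OF assms(3,4)])
  ultimately show ?thesis using assms(4)
    by (simp add: V.smult_l_minus W.smult_l_minus)
qed

lemma linear_map_diff:
  assumes "module K V" "module K W" "linear_map K V W f" "x \<in> carrier V" "y \<in> carrier V"
  shows "f (x \<ominus>\<^bsub>V\<^esub> y) = f x \<ominus>\<^bsub>W\<^esub> f y"
proof -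
  interpret V: module K V by fact
  interpret W: module K W by fact
  show ?thesis using assms(4,5)
    by (simp add: V.minus_eq W.minus_eq linear_map_add[OF assms(3)] linear_map_minus[OF assms(1,2,3)])
qed

lemma linear_map_comp:
  assumes "linear_map K U V f" "linear_map K V W g"
  shows "linear_map K U W (\<lambda>x. g (f x))"
  by (rule linear_mapI) (auto simp: linear_mapD[OF assms(1)] linear_mapD[OF assms(2)])

lemma linear_map_const_smult:
  assumes "module K W" "linear_map K V W f" "a \<in> carrier K"
  shows "linear_map K V W (\<lambda>x. a \<odot>\<^bsub>W\<^esub> f x)"
proof -
  interpret W: module K W by fact
  show ?thesis
    by (rule linear_mapI)
      (use assms in \<open>auto simp: linear_mapD[OF assms(2)] W.smult_r_distr W.m_comm
        simp flip: W.smult_assoc1\<close>)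
qed

lemma linear_map_pointwise_add:
  assumes "module K W" "linear_map K V W f" "linear_map K V W g"
  shows "linear_map K V W (\<lambda>x. f x \<oplus>\<^bsub>W\<^esub> g x)"
proof -
  interpret W: module K W by fact
  show ?thesis
    by (rule linear_mapI)
      (use assms in \<open>auto simp: linear_mapD[OF assms(2)] linear_mapD[OF assms(3)]
        W.smult_r_distr W.a_ac\<close>)
qed

lemma linear_map_pointwise_diff:
  assumes "module K W" "linear_map K V W f" "linear_map K V W g"
  shows "linear_map K V W (\<lambda>x. f x \<ominus>\<^bsub>W\<^esub> g x)"
proof -
  interpret W: module K W by fact
  show ?thesis
    by (rule linear_mapI)
      (use assms in \<open>auto simp: linear_mapD[OF assms(2)] linear_mapD[OF assms(3)] W.minus_eq
        W.smult_r_distr W.smult_r_minus W.minus_add W.a_ac\<close>)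
qed

lemma submodule_diff_closed:
  assumes "module K V" "submodule U K V" "x \<in> U" "y \<in> U"
  shows "x \<ominus>\<^bsub>V\<^esub> y \<in> U"
proof -
  interpret V: module K V by fact
  show ?thesis using assms by (simp add: V.minus_eq V.submoduleE[OF assms(2)])
qed

lemma submodule_zero:
  assumes "module K V" "submodule U K V"
  shows "\<zero>\<^bsub>V\<^esub> \<in> U"
proof -
  interpret V: module K V by fact
  obtain x where "x \<in> U" using V.submoduleE(2)[OF assms(2)] by blast
  then show ?thesis
    using submodule_diff_closed[OF assms, of x x] V.submoduleE(1)[OF assms(2)]
    by (auto simp: V.r_neg V.minus_eq)
qed

lemma linear_preimage_submodule:
  assumes "module K V" "module K W" "linear_map K V W f" "submodule T K W"
  shows "submodule {x \<in> carrier V. f x \<in> T} K V"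
proof -
  interpret V: module K V by fact
  interpret W: module K W by fact
  show ?thesis
    by (rule V.submoduleI)
      (auto simp: linear_mapD[OF assms(3)] linear_map_minus[OF assms(1-3)]
        linear_map_zero[OF assms(1-3)] submodule_zero[OF assms(2,4)] W.submoduleE[OF assms(4)])
qed

lemma mem_set_addI: "a \<in> A \<Longrightarrow> b \<in> B \<Longrightarrow> a \<oplus>\<^bsub>V\<^esub> b \<in> A <+>\<^bsub>V\<^esub> B"
  by (auto simp: set_add_def')

lemma submodule_set_add:
  assumes "module K V" "submodule A K V" "submodule B K V"
  shows "submodule (A <+>\<^bsub>V\<^esub> B) K V"
proof -
  interpret V: module K V by fact
  have A: "\<And>x. x \<in> A \<Longrightarrow> x \<in> carrier V" and B: "\<And>x. x \<in> B \<Longrightarrow> x \<in> carrier V"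
    using V.submoduleE(1) assms by blast+
  show ?thesis
  proof (rule V.submoduleI)
    show "A <+>\<^bsub>V\<^esub> B \<subseteq> carrier V" using A B by (auto simp: set_add_def')
    show "\<zero>\<^bsub>V\<^esub> \<in> A <+>\<^bsub>V\<^esub> B"
      using submodule_zero[OF assms(1,2)] submodule_zero[OF assms(1,3)]
      by (force simp: set_add_def')
  next
    fix x assume "x \<in> A <+>\<^bsub>V\<^esub> B"
    then obtain a b where x: "x = a \<oplus>\<^bsub>V\<^esub> b" "a \<in> A" "b \<in> B" by (auto simp: set_add_def')
    then have "\<ominus>\<^bsub>V\<^esub> x = \<ominus>\<^bsub>V\<^esub> a \<oplus>\<^bsub>V\<^esub> \<ominus>\<^bsub>V\<^esub> b" using A B by (simp add: V.minus_add)
    then show "\<ominus>\<^bsub>V\<^esub> x \<in> A <+>\<^bsub>V\<^esub> B"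
      using x V.submoduleE(3)[OF assms(2)] V.submoduleE(3)[OF assms(3)]
      by (auto simp: set_add_def')
    fix r assume r: "r \<in> carrier K"
    then have "r \<odot>\<^bsub>V\<^esub> x = r \<odot>\<^bsub>V\<^esub> a \<oplus>\<^bsub>V\<^esub> r \<odot>\<^bsub>V\<^esub> b"
      using x A B by (simp add: V.smult_r_distr)
    then show "r \<odot>\<^bsub>V\<^esub> x \<in> A <+>\<^bsub>V\<^esub> B"
      using x r V.submoduleE(4)[OF assms(2)] V.submoduleE(4)[OF assms(3)]
      by (simp add: mem_set_addI)
  next
    fix x y assume "x \<in> A <+>\<^bsub>V\<^esub> B" "y \<in> A <+>\<^bsub>V\<^esub> B"
    then obtain a b a' b' where x: "x = a \<oplus>\<^bsub>V\<^esub> b" "a \<in> A" "b \<in> B"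
      and y: "y = a' \<oplus>\<^bsub>V\<^esub> b'" "a' \<in> A" "b' \<in> B" by (auto simp: set_add_def')
    then have "x \<oplus>\<^bsub>V\<^esub> y = (a \<oplus>\<^bsub>V\<^esub> a') \<oplus>\<^bsub>V\<^esub> (b \<oplus>\<^bsub>V\<^esub> b')"
      using A B by (simp add: V.a_ac)
    then show "x \<oplus>\<^bsub>V\<^esub> y \<in> A <+>\<^bsub>V\<^esub> B"
      using x y V.submoduleE(5)[OF assms(2)] V.submoduleE(5)[OF assms(3)]
      by (simp add: mem_set_addI)
  qed
qed

lemma lin_span_incl: "S \<subseteq> lin_span K V S"
  by (auto simp: lin_span_def)

lemma lin_span_minimal: "submodule U K V \<Longrightarrow> S \<subseteq> U \<Longrightarrow> lin_span K V S \<subseteq> U"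
  by (auto simp: lin_span_def)

lemma lin_span_mono: "S \<subseteq> S' \<Longrightarrow> lin_span K V S \<subseteq> lin_span K V S'"
  by (auto simp: lin_span_def)

lemma lin_span_submodule:
  assumes "module K V" "S \<subseteq> carrier V"
  shows "submodule (lin_span K V S) K V"
proof -
  interpret V: module K V by fact
  show ?thesis
  proof (rule V.submoduleI)
    show "lin_span K V S \<subseteq> carrier V"
      by (rule lin_span_minimal[OF V.carrier_is_submodule assms(2)])
  qed (auto simp: lin_span_def submodule_zero[OF assms(1)] V.submoduleE)
qed

lemma linear_form_imp_linear_map_smult:
  assumes "module K V" "linear_form K V e" "v \<in> carrier V"
  shows "linear_map K V V (\<lambda>x. e x \<odot>\<^bsub>V\<^esub> v)"
proof -
  interpret V: module K V by fact
  show ?thesis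
    by (rule linear_mapI)
      (use assms(2,3) in \<open>auto simp: linear_form_def Pi_def V.smult_l_distr V.smult_assoc1\<close>)
qed


section \<open>The tensor product and its universal property\<close>

definition bilinear_map where
  "bilinear_map K V W N \<beta> \<longleftrightarrow>
    (\<forall>w\<in>carrier W. linear_map K V N (\<lambda>v. \<beta> v w)) \<and> (\<forall>v\<in>carrier V. linear_map K W N (\<beta> v))"

lemma bilinear_mapI:
  assumes "\<And>w. w \<in> carrier W \<Longrightarrow> linear_map K V N (\<lambda>v. \<beta> v w)"
    and "\<And>v. v \<in> carrier V \<Longrightarrow> linear_map K W N (\<beta> v)"
  shows "bilinear_map K V W N \<beta>"
  using assms by (simp add: bilinear_map_def)

locale module_pair = V: module K V + W: module K W
  for K :: "('k, 'm) ring_scheme" and V :: "('k, 'v, 'n) module_scheme"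
    and W :: "('k, 'w, 'p) module_scheme"
begin

text \<open>The formal sums that represent elements of the tensor product.\<close>

definition "sums = lists (carrier V \<times> carrier W)"
abbreviation "cls \<equiv> tensor_class K V W"
abbreviation "T \<equiv> tensor K V W"
abbreviation "scale a \<equiv> map (\<lambda>(v, w). (a \<odot>\<^bsub>V\<^esub> v, w))"

lemma mem_sums_iff: "x \<in> sums \<longleftrightarrow> set x \<subseteq> carrier V \<times> carrier W"
  by (auto simp: sums_def)

lemma sums_simps [simp]:
  "[] \<in> sums"
  "(v, w) # x \<in> sums \<longleftrightarrow> v \<in> carrier V \<and> w \<in> carrier W \<and> x \<in> sums"
  "x @ y \<in> sums \<longleftrightarrow> x \<in> sums \<and> y \<in> sums"
  by (auto simp: sums_def)

lemma tensor_cong_sums: "tensor_cong K V W x y \<Longrightarrow> x \<in> sums \<and> y \<in> sums"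
  by (induction rule: tensor_cong.induct) (auto simp: mem_sums_iff)

lemma class_eqI: "tensor_cong K V W x y \<Longrightarrow> cls x = cls y"
  by (auto simp: tensor_class_def intro: tensor_cong.sym tensor_cong.trans)

lemma self_in_class: "x \<in> sums \<Longrightarrow> x \<in> cls x"
  by (simp add: tensor_class_def tensor_cong.refl mem_sums_iff)

lemma tensor_zero: "\<zero>\<^bsub>T\<^esub> = cls []"
  by (simp add: tensor_def)

lemma tensor_carrier: "carrier T = cls ` sums"
  by (simp add: tensor_def sums_def)

lemma cls_closed: "x \<in> sums \<Longrightarrow> cls x \<in> carrier T"
  by (simp add: tensor_carrier)

lemma tensor_add:
  assumes "x \<in> sums" "y \<in> sums"
  shows "cls x \<oplus>\<^bsub>T\<^esub> cls y = cls (x @ y)"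
proof -
  have "cls (x' @ y') = cls (x @ y)" if "x' \<in> cls x" "y' \<in> cls y" for x' y'
    using that
    by (intro class_eqI[symmetric] tensor_cong.append) (simp_all add: tensor_class_def)
  moreover have "cls x \<noteq> {}" "cls y \<noteq> {}" using self_in_class assms by blast+
  ultimately have "(\<Union>x'\<in>cls x. \<Union>y'\<in>cls y. cls (x' @ y')) = cls (x @ y)"
    by (intro SUP_eq_const)
  then show ?thesis by (simp add: tensor_def)
qed

lemma scale_sums: "a \<in> carrier K \<Longrightarrow> x \<in> sums \<Longrightarrow> scale a x \<in> sums"
  by (auto simp: mem_sums_iff)

lemma scale_cong:
  assumes a: "a \<in> carrier K"
  shows "tensor_cong K V W x y \<Longrightarrow> tensor_cong K V W (scale a x) (scale a y)"
proof (induction rule: tensor_cong.induct)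
  case (refl x)
  then show ?case using scale_sums[OF a, of x] by (simp add: mem_sums_iff tensor_cong.refl)
next
  case (comm x y)
  then show ?case
    using scale_sums[OF a, of x] scale_sums[OF a, of y] by (simp add: mem_sums_iff tensor_cong.comm)
next
  case (smult b v w)
  have "tensor_cong K V W [(b \<odot>\<^bsub>V\<^esub> (a \<odot>\<^bsub>V\<^esub> v), w)] [(a \<odot>\<^bsub>V\<^esub> v, b \<odot>\<^bsub>W\<^esub> w)]"
    using smult a by (intro tensor_cong.smult) auto
  moreover have "b \<odot>\<^bsub>V\<^esub> (a \<odot>\<^bsub>V\<^esub> v) = a \<odot>\<^bsub>V\<^esub> (b \<odot>\<^bsub>V\<^esub> v)"
    using smult a by (simp add: V.m_comm flip: V.smult_assoc1)
  ultimately show ?case by simp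
next
  case (sym x y)
  show ?case using sym.IH by (rule tensor_cong.sym)
next
  case (trans x y z)
  show ?case using trans.IH by (rule tensor_cong.trans)
next
  case (append x y x' y')
  then show ?case by (simp add: tensor_cong.append)
qed (use a in \<open>auto simp: V.smult_r_distr
    intro: tensor_cong.add_left tensor_cong.add_right tensor_cong.zero\<close>)

lemma tensor_smult:
  assumes "a \<in> carrier K" "x \<in> sums"
  shows "a \<odot>\<^bsub>T\<^esub> cls x = cls (scale a x)"
proof -
  have "cls (scale a x') = cls (scale a x)" if "x' \<in> cls x" for x'
    using that
    by (intro class_eqI[symmetric] scale_cong[OF assms(1)]) (simp add: tensor_class_def)
  moreover have "cls x \<noteq> {}" using self_in_class assms by blast
  ultimately have "(\<Union>x'\<in>cls x. cls (scale a x')) = cls (scale a x)"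
    by (intro SUP_eq_const)
  then show ?thesis by (simp add: tensor_def)
qed

lemma tensor_abelian_monoid: "abelian_monoid T"
proof (rule abelian_monoidI)
  fix X Y assume "X \<in> carrier T" "Y \<in> carrier T"
  then obtain x y where xy: "X = cls x" "x \<in> sums" "Y = cls y" "y \<in> sums"
    by (auto simp: tensor_carrier)
  show "X \<oplus>\<^bsub>T\<^esub> Y \<in> carrier T" using xy by (simp add: tensor_add cls_closed)
  have "cls (x @ y) = cls (y @ x)"
    using xy by (intro class_eqI tensor_cong.comm) (simp_all add: mem_sums_iff)
  then show "X \<oplus>\<^bsub>T\<^esub> Y = Y \<oplus>\<^bsub>T\<^esub> X"
    using xy by (simp add: tensor_add)
next
  fix X Y Z assume "X \<in> carrier T" "Y \<in> carrier T" "Z \<in> carrier T"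
  then show "X \<oplus>\<^bsub>T\<^esub> Y \<oplus>\<^bsub>T\<^esub> Z = X \<oplus>\<^bsub>T\<^esub> (Y \<oplus>\<^bsub>T\<^esub> Z)"
    by (auto simp: tensor_carrier tensor_add)
next
  fix X assume "X \<in> carrier T"
  then show "\<zero>\<^bsub>T\<^esub> \<oplus>\<^bsub>T\<^esub> X = X"
    by (auto simp: tensor_carrier tensor_zero tensor_add)
qed (simp add: tensor_zero cls_closed)

sublocale T: abelian_monoid T
  by (rule tensor_abelian_monoid)

lemma cls_Cons:
  assumes "v \<in> carrier V" "w \<in> carrier W" "x \<in> sums"
  shows "cls ((v, w) # x) = pure_tensor K V W v w \<oplus>\<^bsub>T\<^esub> cls x"
  using tensor_add[of "[(v, w)]" x] assms by (simp add: pure_tensor_def)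

lemma pure_closed [simp, intro]:
  assumes "v \<in> carrier V" "w \<in> carrier W"
  shows "pure_tensor K V W v w \<in> carrier T"
  using assms by (auto simp: pure_tensor_def intro!: cls_closed)

lemma pure_smult_left:
  assumes "a \<in> carrier K" "v \<in> carrier V" "w \<in> carrier W"
  shows "pure_tensor K V W (a \<odot>\<^bsub>V\<^esub> v) w = a \<odot>\<^bsub>T\<^esub> pure_tensor K V W v w"
  using assms by (simp add: pure_tensor_def tensor_smult)

lemma pure_smult_right:
  assumes "a \<in> carrier K" "v \<in> carrier V" "w \<in> carrier W"
  shows "pure_tensor K V W v (a \<odot>\<^bsub>W\<^esub> w) = a \<odot>\<^bsub>T\<^esub> pure_tensor K V W v w"
  using assms class_eqI[OF tensor_cong.smult[of a K v V w W]]
  by (simp add: pure_smult_left[symmetric]) (simp add: pure_tensor_def)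

lemma pure_add_left:
  assumes "v \<in> carrier V" "v' \<in> carrier V" "w \<in> carrier W"
  shows "pure_tensor K V W (v \<oplus>\<^bsub>V\<^esub> v') w = pure_tensor K V W v w \<oplus>\<^bsub>T\<^esub> pure_tensor K V W v' w"
  using assms class_eqI[OF tensor_cong.add_left[of v V v' w W K]]
  by (simp add: pure_tensor_def tensor_add)

lemma pure_add_right:
  assumes "v \<in> carrier V" "w \<in> carrier W" "w' \<in> carrier W"
  shows "pure_tensor K V W v (w \<oplus>\<^bsub>W\<^esub> w') = pure_tensor K V W v w \<oplus>\<^bsub>T\<^esub> pure_tensor K V W v w'"
  using assms class_eqI[OF tensor_cong.add_right[of v V w W w' K]]
  by (simp add: pure_tensor_def tensor_add)

lemma pure_zero_left:
  assumes "w \<in> carrier W"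
  shows "pure_tensor K V W \<zero>\<^bsub>V\<^esub> w = \<zero>\<^bsub>T\<^esub>"
  using class_eqI[OF tensor_cong.zero[of w W K V]] assms by (simp add: pure_tensor_def tensor_zero)

lemma scale_zero:
  assumes "x \<in> sums" shows "cls (scale \<zero>\<^bsub>K\<^esub> x) = \<zero>\<^bsub>T\<^esub>"
  using assms
proof (induction x)
  case (Cons p x)
  obtain v w where "p = (v, w)" by (cases p)
  with Cons scale_sums[OF V.R.zero_closed, of x] show ?case
    by (simp add: cls_Cons pure_zero_left)
qed (simp add: tensor_zero)

text \<open>The action of \<open>a \<oplus> b\<close> changes the first factor of each term of a formal sum, whereas the
  right-hand side is represented by a list of twice the length; the two are matched term by
  term.  Together with \<open>scale_zero\<close> this also yields additive inverses, as multiples by \<open>- 1\<close>.\<close>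

lemma tensor_smult_l_distr:
  assumes "a \<in> carrier K" "b \<in> carrier K" "x \<in> sums"
  shows "cls (scale (a \<oplus>\<^bsub>K\<^esub> b) x) = cls (scale a x) \<oplus>\<^bsub>T\<^esub> cls (scale b x)"
  using assms(3)
proof (induction x)
  case (Cons p x)
  obtain v w where p: "p = (v, w)" by (cases p)
  have x: "x \<in> sums" "v \<in> carrier V" "w \<in> carrier W" using Cons.prems p by auto
  note s = scale_sums[OF assms(1) x(1)] scale_sums[OF assms(2) x(1)]
    scale_sums[OF V.R.add.m_closed[OF assms(1,2)] x(1)]
  note c = cls_closed[OF s(1)] cls_closed[OF s(2)]
  show ?case
    using x assms(1,2) Cons.IH[OF x(1)] s c
    by (simp add: p cls_Cons V.smult_l_distr pure_add_left T.a_ac)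
next
  case Nil
  show ?case by (simp add: tensor_add)
qed

lemma tensor_module: "module K T"
proof (rule moduleI)
  show "cring K" by (rule V.is_cring)
  show "abelian_group T"
  proof (rule abelian_groupI)
    fix X assume "X \<in> carrier T"
    then obtain x where x: "X = cls x" "x \<in> sums" by (auto simp: tensor_carrier)
    have "scale \<one>\<^bsub>K\<^esub> x = x" using x(2) by (induction x) (auto simp: sums_def)
    then have "cls (scale (\<ominus>\<^bsub>K\<^esub> \<one>\<^bsub>K\<^esub>) x) \<oplus>\<^bsub>T\<^esub> X = cls (scale (\<ominus>\<^bsub>K\<^esub> \<one>\<^bsub>K\<^esub> \<oplus>\<^bsub>K\<^esub> \<one>\<^bsub>K\<^esub>) x)"
      using x by (simp add: tensor_smult_l_distr)
    also have "\<dots> = \<zero>\<^bsub>T\<^esub>" using x by (simp add: V.R.l_neg scale_zero)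
    finally show "\<exists>Y\<in>carrier T. Y \<oplus>\<^bsub>T\<^esub> X = \<zero>\<^bsub>T\<^esub>"
      using scale_sums[of "\<ominus>\<^bsub>K\<^esub> \<one>\<^bsub>K\<^esub>" x] x(2) by (auto simp: tensor_carrier)
  qed (auto simp: T.a_ac)
next
  fix a b X assume a: "a \<in> carrier K" and "X \<in> carrier T"
  then obtain x where x: "X = cls x" "x \<in> sums" by (auto simp: tensor_carrier)
  then show "a \<odot>\<^bsub>T\<^esub> X \<in> carrier T"
    using scale_sums[OF a x(2)] a by (simp add: tensor_smult cls_closed)
  assume b: "b \<in> carrier K"
  show "(a \<oplus>\<^bsub>K\<^esub> b) \<odot>\<^bsub>T\<^esub> X = a \<odot>\<^bsub>T\<^esub> X \<oplus>\<^bsub>T\<^esub> b \<odot>\<^bsub>T\<^esub> X"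
    using a b x by (simp add: tensor_smult tensor_smult_l_distr)
  have "scale (a \<otimes>\<^bsub>K\<^esub> b) x = scale a (scale b x)"
    using x(2) a b by (induction x) (auto simp: sums_def V.smult_assoc1)
  then show "(a \<otimes>\<^bsub>K\<^esub> b) \<odot>\<^bsub>T\<^esub> X = a \<odot>\<^bsub>T\<^esub> (b \<odot>\<^bsub>T\<^esub> X)"
    using a b x scale_sums[OF b x(2)] by (simp add: tensor_smult del: map_map)
next
  fix X assume "X \<in> carrier T"
  then obtain x where x: "X = cls x" "x \<in> sums" by (auto simp: tensor_carrier)
  have "scale \<one>\<^bsub>K\<^esub> x = x" using x(2) by (induction x) (auto simp: sums_def)
  then show "\<one>\<^bsub>K\<^esub> \<odot>\<^bsub>T\<^esub> X = X" using x by (simp add: tensor_smult)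
next
  fix a X Y assume a: "a \<in> carrier K" and "X \<in> carrier T" "Y \<in> carrier T"
  then obtain x y where "X = cls x" "x \<in> sums" "Y = cls y" "y \<in> sums"
    by (auto simp: tensor_carrier)
  then show "a \<odot>\<^bsub>T\<^esub> (X \<oplus>\<^bsub>T\<^esub> Y) = a \<odot>\<^bsub>T\<^esub> X \<oplus>\<^bsub>T\<^esub> a \<odot>\<^bsub>T\<^esub> Y"
    using a scale_sums[OF a] by (simp add: tensor_smult tensor_add)
qed

lemma pure_bilinear: "bilinear_map K V W T (pure_tensor K V W)"
  by (intro bilinear_mapI linear_mapI)
    (auto simp: pure_add_left pure_add_right pure_smult_left pure_smult_right)

text \<open>Pure tensors span the tensor product.  Membership of all values of a linear map in a
  subspace, and equality of two linear maps, can therefore be tested on pure tensors.\<close>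

lemma carrier_subset_if_pure:
  assumes "submodule U K T"
    and "\<And>v w. v \<in> carrier V \<Longrightarrow> w \<in> carrier W \<Longrightarrow> pure_tensor K V W v w \<in> U"
  shows "carrier T \<subseteq> U"
proof -
  have "cls x \<in> U" if "x \<in> sums" for x
    using that
  proof (induction x)
    case Nil
    show ?case using submodule_zero[OF tensor_module assms(1)] by (simp add: tensor_zero)
  next
    case (Cons p x)
    obtain v w where p: "p = (v, w)" by (cases p)
    show ?case
      using Cons p assms(2) module.submoduleE(5)[OF tensor_module assms(1)]
      by (simp add: cls_Cons)
  qed
  then show ?thesis by (auto simp: tensor_carrier)
qed

lemma linear_map_mem_if_pure:
  assumes "module K N" "linear_map K T N f" "submodule U K N"
    and "\<And>v w. v \<in> carrier V \<Longrightarrow> w \<in> carrier W \<Longrightarrow> f (pure_tensor K V W v w) \<in> U"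
    and "X \<in> carrier T"
  shows "f X \<in> U"
  using carrier_subset_if_pure[OF linear_preimage_submodule[OF tensor_module assms(1-3)]] assms(4,5)
  by auto

lemma linear_map_eq_if_pure:
  assumes "module K N" "linear_map K T N f" "linear_map K T N g"
    and "\<And>v w. v \<in> carrier V \<Longrightarrow> w \<in> carrier W \<Longrightarrow>
      f (pure_tensor K V W v w) = g (pure_tensor K V W v w)"
    and "X \<in> carrier T"
  shows "f X = g X"
proof -
  interpret N: module K N by fact
  have "submodule {\<zero>\<^bsub>N\<^esub>} K N" by (rule N.submoduleI) auto
  from linear_map_mem_if_pure[OF assms(1) linear_map_pointwise_diff[OF assms(1-3)] this _ assms(5)]
  have "f X \<ominus>\<^bsub>N\<^esub> g X \<in> {\<zero>\<^bsub>N\<^esub>}"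
    using assms(4) linear_map_closed[OF assms(3)] by (simp add: N.minus_eq N.r_neg)
  then have "f X \<oplus>\<^bsub>N\<^esub> \<ominus>\<^bsub>N\<^esub> g X = \<zero>\<^bsub>N\<^esub>" by (simp add: N.minus_eq)
  then show ?thesis
    using linear_map_closed[OF assms(2,5)] linear_map_closed[OF assms(3,5)]
    by (metis N.M.minus_equality N.M.minus_minus N.M.add.inv_closed)
qed

text \<open>The universal property.  Each generating relation of the tensor product holds after evaluation
  of a bilinear map, so evaluation is constant on classes.\<close>

context
  fixes N :: "('k, 'u, 'q) module_scheme" and \<beta>
  assumes N: "module K N" and \<beta>: "bilinear_map K V W N \<beta>"
begin

interpretation N: module K N by (rule N)

abbreviation "eval_sum x \<equiv> foldr (\<lambda>(v, w) n. \<beta> v w \<oplus>\<^bsub>N\<^esub> n) x \<zero>\<^bsub>N\<^esub>"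

lemma \<beta>_left: "w \<in> carrier W \<Longrightarrow> linear_map K V N (\<lambda>v. \<beta> v w)"
  and \<beta>_right: "v \<in> carrier V \<Longrightarrow> linear_map K W N (\<beta> v)"
  using \<beta> by (auto simp: bilinear_map_def)

lemma \<beta>_closed: "v \<in> carrier V \<Longrightarrow> w \<in> carrier W \<Longrightarrow> \<beta> v w \<in> carrier N"
  by (rule linear_map_closed[OF \<beta>_right])

lemma eval_sum_closed: "x \<in> sums \<Longrightarrow> eval_sum x \<in> carrier N"
  by (induction x) (auto simp: sums_def \<beta>_closed)

lemma eval_sum_append: "x \<in> sums \<Longrightarrow> y \<in> sums \<Longrightarrow> eval_sum (x @ y) = eval_sum x \<oplus>\<^bsub>N\<^esub> eval_sum y"
proof (induction x)
  case (Cons p x)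
  obtain v w where p: "p = (v, w)" by (cases p)
  have x: "x \<in> sums" "v \<in> carrier V" "w \<in> carrier W" using Cons.prems p by auto
  then show ?case
    using Cons.IH[OF x(1) Cons.prems(2)] eval_sum_closed[OF x(1)] eval_sum_closed[OF Cons.prems(2)]
    by (simp add: p N.a_assoc \<beta>_closed)
qed (simp add: eval_sum_closed)

lemma eval_sum_cong: "tensor_cong K V W x y \<Longrightarrow> eval_sum x = eval_sum y"
proof (induction rule: tensor_cong.induct)
  case (append x y x' y')
  then show ?case by (metis tensor_cong_sums eval_sum_append)
next
  case (comm x y)
  then have "x \<in> sums" "y \<in> sums" by (simp_all add: mem_sums_iff)
  then show ?case
    by (simp add: eval_sum_append eval_sum_closed N.M.a_comm del: foldr_append)
next
  case (zero w)
  then show ?case using linear_map_zero[OF V.module_axioms N \<beta>_left] by auto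
qed (auto simp: linear_mapD[OF \<beta>_left] linear_mapD[OF \<beta>_right] \<beta>_closed)

lemma tensor_lift_class:
  assumes "x \<in> sums"
  shows "tensor_lift N \<beta> (cls x) = eval_sum x"
proof -
  have "eval_sum ` cls x = {eval_sum x}"
    using self_in_class[OF assms] by (auto simp: tensor_class_def dest: eval_sum_cong)
  then show ?thesis by (simp add: tensor_lift_def)
qed

lemma tensor_lift_pure:
  assumes "v \<in> carrier V" "w \<in> carrier W"
  shows "tensor_lift N \<beta> (pure_tensor K V W v w) = \<beta> v w"
  using assms by (simp add: pure_tensor_def tensor_lift_class \<beta>_closed)

lemma eval_sum_scale:
  assumes "a \<in> carrier K" "x \<in> sums"
  shows "eval_sum (scale a x) = a \<odot>\<^bsub>N\<^esub> eval_sum x"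
  using assms(2)
proof (induction x)
  case (Cons p x)
  obtain v w where p: "p = (v, w)" by (cases p)
  have x: "x \<in> sums" "v \<in> carrier V" "w \<in> carrier W" using Cons.prems p by auto
  then show ?case
    using Cons.IH[OF x(1)] eval_sum_closed[OF x(1)] assms(1)
    by (simp add: p N.smult_r_distr \<beta>_closed linear_map_smult[OF \<beta>_left])
qed (use assms in simp)

lemma tensor_lift_linear: "linear_map K T N (tensor_lift N \<beta>)"
proof (rule linear_mapI)
  fix X assume "X \<in> carrier T"
  then obtain x where x: "X = cls x" "x \<in> sums" by (auto simp: tensor_carrier)
  then show "tensor_lift N \<beta> X \<in> carrier N"
    by (simp add: tensor_lift_class eval_sum_closed)
  fix a assume a: "a \<in> carrier K"
  show "tensor_lift N \<beta> (a \<odot>\<^bsub>T\<^esub> X) = a \<odot>\<^bsub>N\<^esub> tensor_lift N \<beta> X"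
    using x a scale_sums[OF a x(2)]
    by (simp add: tensor_smult tensor_lift_class eval_sum_scale)
next
  fix X Y assume "X \<in> carrier T" "Y \<in> carrier T"
  then obtain x y where xy: "X = cls x" "x \<in> sums" "Y = cls y" "y \<in> sums"
    by (auto simp: tensor_carrier)
  then have "x @ y \<in> sums" by simp
  then have "tensor_lift N \<beta> (cls (x @ y)) = eval_sum (x @ y)" by (rule tensor_lift_class)
  with xy show "tensor_lift N \<beta> (X \<oplus>\<^bsub>T\<^esub> Y) = tensor_lift N \<beta> X \<oplus>\<^bsub>N\<^esub> tensor_lift N \<beta> Y"
    by (simp add: tensor_add tensor_lift_class eval_sum_append del: foldr_append)
qed

end

end


section \<open>Tensor products of linear maps and of actions\<close>

lemma bilinear_map_comp:
  assumes "bilinear_map K V' W' N \<beta>" "linear_map K V V' f" "linear_map K W W' g"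
  shows "bilinear_map K V W N (\<lambda>v w. \<beta> (f v) (g w))"
proof (rule bilinear_mapI)
  fix w assume "w \<in> carrier W"
  then have "linear_map K V' N (\<lambda>v. \<beta> v (g w))"
    using assms(1) linear_map_closed[OF assms(3)] by (simp add: bilinear_map_def)
  then show "linear_map K V N (\<lambda>v. \<beta> (f v) (g w))"
    by (rule linear_map_comp[OF assms(2)])
next
  fix v assume "v \<in> carrier V"
  then have "linear_map K W' N (\<beta> (f v))"
    using assms(1) linear_map_closed[OF assms(2)] by (simp add: bilinear_map_def)
  then show "linear_map K W N (\<lambda>w. \<beta> (f v) (g w))"
    by (rule linear_map_comp[OF assms(3)])
qed

lemma
  assumes V: "module K V" and W: "module K W" and V': "module K V'" and W': "module K W'"
    and f: "linear_map K V V' f" and g: "linear_map K W W' g"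
  shows tensor_map_linear:
      "linear_map K (tensor K V W) (tensor K V' W') (tensor_map K V' W' f g)"
    and tensor_map_pure: "\<And>v w. v \<in> carrier V \<Longrightarrow> w \<in> carrier W \<Longrightarrow>
      tensor_map K V' W' f g (pure_tensor K V W v w) = pure_tensor K V' W' (f v) (g w)"
proof -
  interpret T: module_pair K V W using V W by (simp add: module_pair_def)
  interpret T': module_pair K V' W' using V' W' by (simp add: module_pair_def)
  note \<beta> = bilinear_map_comp[OF T'.pure_bilinear f g]
  show "linear_map K (tensor K V W) (tensor K V' W') (tensor_map K V' W' f g)"
    unfolding tensor_map_def by (rule T.tensor_lift_linear[OF T'.tensor_module \<beta>])
  show "tensor_map K V' W' f g (pure_tensor K V W v w) = pure_tensor K V' W' (f v) (g w)"
    if "v \<in> carrier V" "w \<in> carrier W" for v w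
    unfolding tensor_map_def using T.tensor_lift_pure[OF T'.tensor_module \<beta> that] .
qed

text \<open>Additivity in the parameter \<open>a\<close> is, for two given values of \<open>a\<close>, an equality of linear
  maps on the tensor product, and so may be checked on pure tensors.\<close>

lemma (in module_pair) linear_in_parameter_if_pure:
  assumes A: "module K A" and N: "module K N"
    and F: "\<And>a. a \<in> carrier A \<Longrightarrow> linear_map K T N (F a)"
    and pure: "\<And>v w. v \<in> carrier V \<Longrightarrow> w \<in> carrier W \<Longrightarrow>
      linear_map K A N (\<lambda>a. F a (pure_tensor K V W v w))"
    and Y: "Y \<in> carrier T"
  shows "linear_map K A N (\<lambda>a. F a Y)"
proof -
  interpret A: module K A by (rule A)
  interpret N: module K N by (rule N)
  show ?thesis
  proof (rule linear_mapI)
    fix a assume a: "a \<in> carrier A"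
    show "F a Y \<in> carrier N" by (rule linear_map_closed[OF F[OF a] Y])
    fix r assume r: "r \<in> carrier K"
    show "F (r \<odot>\<^bsub>A\<^esub> a) Y = r \<odot>\<^bsub>N\<^esub> F a Y"
      by (rule linear_map_eq_if_pure[OF N F linear_map_const_smult[OF N F] _ Y])
        (use a r in \<open>auto simp: linear_map_smult[OF pure]\<close>)
  next
    fix a b assume ab: "a \<in> carrier A" "b \<in> carrier A"
    show "F (a \<oplus>\<^bsub>A\<^esub> b) Y = F a Y \<oplus>\<^bsub>N\<^esub> F b Y"
      by (rule linear_map_eq_if_pure[OF N F linear_map_pointwise_add[OF N F F] _ Y])
        (use ab in \<open>auto simp: linear_map_add[OF pure]\<close>)
  qed
qed

lemma tensor_act_eq_lift:
  "tensor_act K V \<mu> X Y =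
    tensor_lift (tensor K V V) (\<lambda>a b. tensor_map K V V (\<mu> a) (\<mu> b) Y) X"
  by (simp add: tensor_act_def tensor_map_def)

locale bilinear_action = A: module K A + V: module K V
  for K :: "('k, 'm) ring_scheme" and A :: "('k, 'a, 'n) module_scheme"
    and V :: "('k, 'v, 'p) module_scheme" and \<mu> :: "'a \<Rightarrow> 'v \<Rightarrow> 'v" +
  assumes bilinear: "bilinear_map K A V V \<mu>"
begin

sublocale TA: module_pair K A A ..
sublocale TV: module_pair K V V ..

lemma \<mu>_left: "v \<in> carrier V \<Longrightarrow> linear_map K A V (\<lambda>a. \<mu> a v)"
  and \<mu>_right: "a \<in> carrier A \<Longrightarrow> linear_map K V V (\<mu> a)"
  using bilinear by (auto simp: bilinear_map_def)

abbreviation "act2 a b \<equiv> tensor_map K V V (\<mu> a) (\<mu> b)"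

lemma act2_linear:
  "a \<in> carrier A \<Longrightarrow> b \<in> carrier A \<Longrightarrow> linear_map K TV.T TV.T (act2 a b)"
  by (intro tensor_map_linear V.module_axioms \<mu>_right)

lemma act2_pure:
  assumes "a \<in> carrier A" "b \<in> carrier A" "v \<in> carrier V" "w \<in> carrier V"
  shows "act2 a b (pure_tensor K V V v w) = pure_tensor K V V (\<mu> a v) (\<mu> b w)"
  using assms by (intro tensor_map_pure V.module_axioms \<mu>_right)

text \<open>Without this bilinearity the lift that defines \<open>tensor_act\<close> need not respect the classes of
  formal sums in \<open>A \<otimes> A\<close>.\<close>

lemma act2_bilinear:
  assumes Y: "Y \<in> carrier TV.T"
  shows "bilinear_map K A A TV.T (\<lambda>a b. act2 a b Y)"
proof (rule bilinear_mapI)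
  fix b assume b: "b \<in> carrier A"
  show "linear_map K A TV.T (\<lambda>a. act2 a b Y)"
  proof (rule TV.linear_in_parameter_if_pure[OF A.module_axioms TV.tensor_module _ _ Y])
    fix v w assume vw: "v \<in> carrier V" "w \<in> carrier V"
    then have w: "\<mu> b w \<in> carrier V" using b linear_map_closed[OF \<mu>_right] by simp
    have "linear_map K V TV.T (\<lambda>x. pure_tensor K V V x (\<mu> b w))"
      using TV.pure_bilinear w by (simp add: bilinear_map_def)
    from linear_map_comp[OF \<mu>_left[OF vw(1)] this]
    have "linear_map K A TV.T (\<lambda>a. pure_tensor K V V (\<mu> a v) (\<mu> b w))" .
    then show "linear_map K A TV.T (\<lambda>a. act2 a b (pure_tensor K V V v w))"
      using b vw by (simp add: linear_map_def Pi_def act2_pure)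
  qed (rule act2_linear[OF _ b])
next
  fix a assume a: "a \<in> carrier A"
  show "linear_map K A TV.T (\<lambda>b. act2 a b Y)"
  proof (rule TV.linear_in_parameter_if_pure[OF A.module_axioms TV.tensor_module _ _ Y])
    fix v w assume vw: "v \<in> carrier V" "w \<in> carrier V"
    then have v: "\<mu> a v \<in> carrier V" using a linear_map_closed[OF \<mu>_right] by simp
    have "linear_map K V TV.T (pure_tensor K V V (\<mu> a v))"
      using TV.pure_bilinear v by (simp add: bilinear_map_def)
    from linear_map_comp[OF \<mu>_left[OF vw(2)] this]
    have "linear_map K A TV.T (\<lambda>b. pure_tensor K V V (\<mu> a v) (\<mu> b w))" .
    then show "linear_map K A TV.T (\<lambda>b. act2 a b (pure_tensor K V V v w))"
      using a vw by (simp add: linear_map_def Pi_def act2_pure)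
  qed (rule act2_linear[OF a])
qed

lemma act2_left: "Y \<in> carrier TV.T \<Longrightarrow> b \<in> carrier A \<Longrightarrow> linear_map K A TV.T (\<lambda>a. act2 a b Y)"
  and act2_right: "Y \<in> carrier TV.T \<Longrightarrow> a \<in> carrier A \<Longrightarrow> linear_map K A TV.T (\<lambda>b. act2 a b Y)"
  using act2_bilinear by (auto simp: bilinear_map_def)

lemma tensor_act_linear:
  "Y \<in> carrier TV.T \<Longrightarrow> linear_map K TA.T TV.T (\<lambda>X. tensor_act K V \<mu> X Y)"
  unfolding tensor_act_eq_lift
  by (rule TA.tensor_lift_linear[OF TV.tensor_module act2_bilinear])

lemma tensor_act_pure:
  assumes "Y \<in> carrier TV.T" "a \<in> carrier A" "b \<in> carrier A"
  shows "tensor_act K V \<mu> (pure_tensor K A A a b) Y = act2 a b Y"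
  unfolding tensor_act_eq_lift
  using TA.tensor_lift_pure[OF TV.tensor_module act2_bilinear[OF assms(1)] assms(2,3)] .

end


section \<open>The coideal generated by a left coideal\<close>

lemma tensor_subspace_submodule:
  assumes "module K V" "module K W" "A \<subseteq> carrier V" "B \<subseteq> carrier W"
  shows "submodule (tensor_subspace K V W A B) K (tensor K V W)"
proof -
  interpret module_pair K V W using assms(1,2) by (simp add: module_pair_def)
  show ?thesis
    unfolding tensor_subspace_def
    by (rule lin_span_submodule[OF tensor_module]) (use assms(3,4) in auto)
qed

lemma pure_mem_tensor_subspace:
  "a \<in> A \<Longrightarrow> b \<in> B \<Longrightarrow> pure_tensor K V W a b \<in> tensor_subspace K V W A B"
  unfolding tensor_subspace_def by (rule subsetD[OF lin_span_incl]) auto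

lemma tensor_subspace_mono:
  assumes "A \<subseteq> A'" "B \<subseteq> B'" 
  shows "tensor_subspace K V W A B \<subseteq> tensor_subspace K V W A' B'"
  unfolding tensor_subspace_def by (rule lin_span_mono) (use assms in blast)

lemma linear_form_zeros_submodule:
  assumes "module K V" "linear_form K V e"
  shows "submodule {x \<in> carrier V. e x = \<zero>\<^bsub>K\<^esub>} K V"
proof -
  interpret V: module K V by fact
  have add: "e (x \<oplus>\<^bsub>V\<^esub> y) = e x \<oplus>\<^bsub>K\<^esub> e y" if "x \<in> carrier V" "y \<in> carrier V" for x y
    using assms(2) that by (simp add: linear_form_def)
  have smult: "e (a \<odot>\<^bsub>V\<^esub> x) = a \<otimes>\<^bsub>K\<^esub> e x" if "a \<in> carrier K" "x \<in> carrier V" for a x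
    using assms(2) that by (simp add: linear_form_def)
  have closed: "e x \<in> carrier K" if "x \<in> carrier V" for x
    using assms(2) that by (auto simp: linear_form_def)
  have "e (\<ominus>\<^bsub>V\<^esub> x) = \<ominus>\<^bsub>K\<^esub> e x" if "x \<in> carrier V" for x
    using smult[of "\<ominus>\<^bsub>K\<^esub> \<one>\<^bsub>K\<^esub>" x] that closed[OF that] by (simp add: V.smult_l_minus V.l_minus)
  moreover have "e \<zero>\<^bsub>V\<^esub> = \<zero>\<^bsub>K\<^esub>" using smult[of "\<zero>\<^bsub>K\<^esub>" "\<zero>\<^bsub>V\<^esub>"] closed by simp
  ultimately show ?thesis
    by (intro V.submoduleI) (auto simp: add smult)
qed

locale bialgebra_module_coalgebra =
  fixes K :: "('k, 'm) ring_scheme"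
    and H :: "('k, 'h, 'n) coalgebra_scheme"
    and C :: "('k, 'c, 'p) coalgebra_scheme"
    and act :: "'h \<Rightarrow> 'c \<Rightarrow> 'c"
  assumes bialgebra: "bialgebra K H"
    and module_coalgebra: "left_module_coalgebra K H C act"
begin

sublocale bilinear_action K H C act
proof -
  have "module K H" "module K C"
    using bialgebra module_coalgebra
    by (simp_all add: bialgebra_def is_coalgebra_def left_module_coalgebra_def)
  moreover have "bilinear_map K H C C act"
    using module_coalgebra
    by (simp add: bilinear_map_def left_module_coalgebra_def left_module_def eta_contract_eq)
  ultimately show "bilinear_action K H C act"
    by (simp add: bilinear_action_def bilinear_action_axioms_def)
qed

abbreviation "HH \<equiv> tensor K H H"
abbreviation "CC \<equiv> tensor K C C"
abbreviation "\<epsilon> \<equiv> counit H"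
abbreviation "\<Delta> \<equiv> comult C"

lemma one_closed: "\<one>\<^bsub>H\<^esub> \<in> carrier H"
proof -
  have "ring H" using bialgebra by (simp add: bialgebra_def unital_algebra_def)
  then interpret ring H .
  show ?thesis by simp
qed

lemma comult_linear_H: "linear_map K H HH (comult H)"
  and comult_linear: "linear_map K C CC \<Delta>"
  and counit_form_H: "linear_form K H \<epsilon>"
  and counit_form: "linear_form K C (counit C)"
  using bialgebra module_coalgebra
  by (simp_all add: bialgebra_def is_coalgebra_def left_module_coalgebra_def)

lemma counit_right: "h \<in> carrier H \<Longrightarrow> tensor_lift H (\<lambda>x y. \<epsilon> y \<odot>\<^bsub>H\<^esub> x) (comult H h) = h"
  using bialgebra by (simp add: bialgebra_def is_coalgebra_def)

lemma counit_one: "\<epsilon> \<one>\<^bsub>H\<^esub> = \<one>\<^bsub>K\<^esub>"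
  using bialgebra by (simp add: bialgebra_def)

lemma counit_closed: "h \<in> carrier H \<Longrightarrow> \<epsilon> h \<in> carrier K"
  and counit_add: "h \<in> carrier H \<Longrightarrow> g \<in> carrier H \<Longrightarrow> \<epsilon> (h \<oplus>\<^bsub>H\<^esub> g) = \<epsilon> h \<oplus>\<^bsub>K\<^esub> \<epsilon> g"
  and counit_smult: "a \<in> carrier K \<Longrightarrow> h \<in> carrier H \<Longrightarrow> \<epsilon> (a \<odot>\<^bsub>H\<^esub> h) = a \<otimes>\<^bsub>K\<^esub> \<epsilon> h"
  using counit_form_H by (auto simp: linear_form_def)

lemma counit_closed_C: "c \<in> carrier C \<Longrightarrow> counit C c \<in> carrier K"
  using counit_form by (auto simp: linear_form_def)

lemma act_one: "c \<in> carrier C \<Longrightarrow> act \<one>\<^bsub>H\<^esub> c = c"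
  and comult_act: "h \<in> carrier H \<Longrightarrow> c \<in> carrier C \<Longrightarrow>
    \<Delta> (act h c) = tensor_act K C act (comult H h) (\<Delta> c)"
  and counit_act: "h \<in> carrier H \<Longrightarrow> c \<in> carrier C \<Longrightarrow>
    counit C (act h c) = \<epsilon> h \<otimes>\<^bsub>K\<^esub> counit C c"
  using module_coalgebra by (simp_all add: left_module_coalgebra_def left_module_def)

lemma act_closed: "h \<in> carrier H \<Longrightarrow> c \<in> carrier C \<Longrightarrow> act h c \<in> carrier C"
  by (rule linear_map_closed[OF \<mu>_right])

text \<open>The projection of \<open>H\<close> onto the augmentation ideal \<open>H\<^sup>+\<close> along \<open>k1\<close>.\<close>

definition reduced :: "'h \<Rightarrow> 'h"
  where "reduced h = h \<ominus>\<^bsub>H\<^esub> \<epsilon> h \<odot>\<^bsub>H\<^esub> \<one>\<^bsub>H\<^esub>"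

lemma reduced_linear: "linear_map K H H reduced"
  unfolding reduced_def
  by (rule linear_map_pointwise_diff[OF A.module_axioms _
        linear_form_imp_linear_map_smult[OF A.module_axioms counit_form_H one_closed]])
    (simp add: linear_map_def)

lemma reduced_closed: "h \<in> carrier H \<Longrightarrow> reduced h \<in> carrier H"
  by (rule linear_map_closed[OF reduced_linear])

lemma reduced_eq: "h \<in> carrier H \<Longrightarrow> reduced h = h \<oplus>\<^bsub>H\<^esub> (\<ominus>\<^bsub>K\<^esub> \<epsilon> h) \<odot>\<^bsub>H\<^esub> \<one>\<^bsub>H\<^esub>"
  by (simp add: reduced_def A.minus_eq A.smult_l_minus counit_closed one_closed)

lemma counit_reduced: "h \<in> carrier H \<Longrightarrow> \<epsilon> (reduced h) = \<zero>\<^bsub>K\<^esub>"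
  by (simp add: reduced_eq counit_add counit_smult counit_closed one_closed counit_one A.R.r_neg)

lemma linear_map_reduced:
  assumes "module K N" "linear_map K H N f" "h \<in> carrier H"
  shows "f (reduced h) = f h \<ominus>\<^bsub>N\<^esub> \<epsilon> h \<odot>\<^bsub>N\<^esub> f \<one>\<^bsub>H\<^esub>"
  using assms one_closed counit_closed[OF assms(3)]
  by (simp add: reduced_def linear_map_diff[OF A.module_axioms assms(1,2)]
      linear_map_smult[OF assms(2)])

text \<open>The subspace \<open>(I + k1)\<^sup>+\<close> is the image of \<open>I\<close> itself under a linear map that does not
  depend on \<open>I\<close>; this is why \<open>(I + k1)\<^sup>+ C\<close> commutes with sums of left coideals.\<close>

lemma augmentation_plus_scalars:
  assumes "submodule I K H"
  shows "augmentation_part K H (plus_scalars K H I) = reduced ` I"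
proof
  have I: "x \<in> carrier H" if "x \<in> I" for x using A.submoduleE(1)[OF assms] that by blast
  show "reduced ` I \<subseteq> augmentation_part K H (plus_scalars K H I)"
  proof
    fix v assume "v \<in> reduced ` I"
    then obtain x where x: "x \<in> I" "v = reduced x" by blast
    have "x \<oplus>\<^bsub>H\<^esub> (\<ominus>\<^bsub>K\<^esub> \<epsilon> x) \<odot>\<^bsub>H\<^esub> \<one>\<^bsub>H\<^esub> \<in> plus_scalars K H I"
      unfolding plus_scalars_def
      by (rule mem_set_addI) (use x I counit_closed in auto)
    then show "v \<in> augmentation_part K H (plus_scalars K H I)"
      using x I by (simp add: augmentation_part_def counit_reduced reduced_eq[symmetric])
  qed
  show "augmentation_part K H (plus_scalars K H I) \<subseteq> reduced ` I"
  proof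
    fix v assume "v \<in> augmentation_part K H (plus_scalars K H I)"
    then obtain x a where v: "x \<in> I" "a \<in> carrier K" "v = x \<oplus>\<^bsub>H\<^esub> a \<odot>\<^bsub>H\<^esub> \<one>\<^bsub>H\<^esub>"
      and "\<epsilon> v = \<zero>\<^bsub>K\<^esub>"
      by (auto simp: augmentation_part_def plus_scalars_def set_add_def')
    then have "\<epsilon> x \<oplus>\<^bsub>K\<^esub> a = \<zero>\<^bsub>K\<^esub>"
      using I by (simp add: counit_add counit_smult counit_one one_closed)
    then have "a = \<ominus>\<^bsub>K\<^esub> \<epsilon> x"
      using v I counit_closed A.R.sum_zero_eq_neg A.R.a_comm by metis
    then show "v \<in> reduced ` I" using v I by (auto simp: reduced_eq)
  qed
qed

definition generated_coideal :: "'h set \<Rightarrow> 'c set"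
  where "generated_coideal I =
    action_span K C act (augmentation_part K H (plus_scalars K H I))"

lemma generated_coideal_eq:
  assumes "submodule I K H"
  shows "generated_coideal I = lin_span K C {act (reduced x) c |x c. x \<in> I \<and> c \<in> carrier C}"
  unfolding generated_coideal_def augmentation_plus_scalars[OF assms] action_span_def
  by (rule arg_cong[where f = "lin_span K C"]) auto

lemma generated_coideal_submodule:
  assumes "submodule I K H"
  shows "submodule (generated_coideal I) K C"
  unfolding generated_coideal_eq[OF assms]
  by (rule lin_span_submodule)
    (use A.submoduleE(1)[OF assms] in \<open>auto simp: V.module_axioms intro!: act_closed reduced_closed\<close>)

lemma act_reduced_mem_generated:
  "submodule I K H \<Longrightarrow> x \<in> I \<Longrightarrow> c \<in> carrier C \<Longrightarrow> act (reduced x) c \<in> generated_coideal I"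
  unfolding generated_coideal_eq by (rule subsetD[OF lin_span_incl]) auto

lemma generated_coideal_minimal:
  assumes "submodule I K H" "submodule U K C"
    and "\<And>x c. x \<in> I \<Longrightarrow> c \<in> carrier C \<Longrightarrow> act (reduced x) c \<in> U"
  shows "generated_coideal I \<subseteq> U"
  unfolding generated_coideal_eq[OF assms(1)] by (rule lin_span_minimal) (use assms(2,3) in auto)

lemma generated_coideal_mono:
  "submodule I K H \<Longrightarrow> submodule I' K H \<Longrightarrow> I \<subseteq> I' \<Longrightarrow> generated_coideal I \<subseteq> generated_coideal I'"
  unfolding generated_coideal_eq by (rule lin_span_mono) blast

lemma act2_one_one:
  assumes "Y \<in> carrier CC" shows "act2 \<one>\<^bsub>H\<^esub> \<one>\<^bsub>H\<^esub> Y = Y"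
proof (rule TV.linear_map_eq_if_pure[OF TV.tensor_module act2_linear[OF one_closed one_closed] _ _ assms])
  show "linear_map K CC CC (\<lambda>Y. Y)" by (simp add: linear_map_def)
qed (simp add: act2_pure one_closed act_one)

text \<open>Modulo \<open>C \<otimes> (I + k1)\<^sup>+ C\<close> an element \<open>i\<close> of \<open>I\<close> acts on the second factor as the scalar
  \<open>\<epsilon> i\<close>, so that \<open>h \<otimes> i\<close> acts like \<open>\<epsilon>(i) h \<otimes> 1\<close>.  For \<open>X = \<Delta> x\<close> the contraction
  \<open>h \<otimes> i \<mapsto> \<epsilon>(i) h\<close> returns \<open>x\<close>.\<close>

lemma tensor_act_mod_right:
  assumes I: "submodule I K H" and X: "X \<in> tensor_subspace K H H (carrier H) I"
    and Y: "Y \<in> carrier CC"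
  shows "tensor_act K C act X Y \<ominus>\<^bsub>CC\<^esub> act2 (tensor_lift H (\<lambda>x y. \<epsilon> y \<odot>\<^bsub>H\<^esub> x) X) \<one>\<^bsub>H\<^esub> Y
    \<in> tensor_subspace K C C (carrier C) (generated_coideal I)" (is "?D X \<in> ?N")
proof -
  have I_sub: "I \<subseteq> carrier H" by (rule A.submoduleE(1)[OF I])
  have N: "submodule ?N K CC"
    by (rule tensor_subspace_submodule[OF V.module_axioms V.module_axioms subset_refl
          V.submoduleE(1)[OF generated_coideal_submodule[OF I]]])
  have \<beta>: "bilinear_map K H H H (\<lambda>x y. \<epsilon> y \<odot>\<^bsub>H\<^esub> x)"
  proof (rule bilinear_mapI)
    show "linear_map K H H (\<lambda>y. \<epsilon> y \<odot>\<^bsub>H\<^esub> x)" if "x \<in> carrier H" for x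
      by (rule linear_form_imp_linear_map_smult[OF A.module_axioms counit_form_H that])
    show "linear_map K H H (\<lambda>x. \<epsilon> y \<odot>\<^bsub>H\<^esub> x)" if "y \<in> carrier H" for y
      by (rule linear_map_const_smult[OF A.module_axioms _ counit_closed[OF that]])
        (simp add: linear_map_def)
  qed
  have lin: "linear_map K HH CC ?D"
    by (intro linear_map_pointwise_diff[OF TV.tensor_module] tensor_act_linear[OF Y]
        linear_map_comp[OF TA.tensor_lift_linear[OF A.module_axioms \<beta>] act2_left[OF Y one_closed]])
  have "tensor_subspace K H H (carrier H) I \<subseteq> {X \<in> carrier HH. ?D X \<in> ?N}"
    unfolding tensor_subspace_def[of K H H]
  proof (rule lin_span_minimal)
    show "submodule {X \<in> carrier HH. ?D X \<in> ?N} K HH"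
      by (rule linear_preimage_submodule[OF TA.tensor_module TV.tensor_module lin N])
    have "?D (pure_tensor K H H h i) \<in> ?N" if hi: "h \<in> carrier H" "i \<in> I" for h i
    proof -
      have i: "i \<in> carrier H" using hi I_sub by blast
      have "?D (pure_tensor K H H h i) = act2 h i Y \<ominus>\<^bsub>CC\<^esub> act2 (\<epsilon> i \<odot>\<^bsub>H\<^esub> h) \<one>\<^bsub>H\<^esub> Y"
        using hi i Y by (simp add: tensor_act_pure TA.tensor_lift_pure[OF A.module_axioms \<beta>])
      also have "\<dots> = act2 h i Y \<ominus>\<^bsub>CC\<^esub> \<epsilon> i \<odot>\<^bsub>CC\<^esub> act2 h \<one>\<^bsub>H\<^esub> Y"
        using linear_map_smult[OF act2_left[OF Y one_closed] counit_closed[OF i] hi(1)] by simp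
      also have "\<dots> = act2 h (reduced i) Y"
        using linear_map_reduced[OF TV.tensor_module act2_right[OF Y hi(1)] i] by simp
      also have "\<dots> \<in> ?N"
      proof (rule TV.linear_map_mem_if_pure[OF TV.tensor_module
              act2_linear[OF hi(1) reduced_closed[OF i]] N _ Y])
        fix c d assume "c \<in> carrier C" "d \<in> carrier C"
        then show "act2 h (reduced i) (pure_tensor K C C c d) \<in> ?N"
          using hi i by (simp add: act2_pure reduced_closed pure_mem_tensor_subspace act_closed
              act_reduced_mem_generated[OF I])
      qed
      finally show ?thesis .
    qed
    then show "{pure_tensor K H H h i |h i. h \<in> carrier H \<and> i \<in> I}
        \<subseteq> {X \<in> carrier HH. ?D X \<in> ?N}"
      using I_sub by auto
  qed
  then show ?thesis using X by blast
qed

text \<open>Writing \<open>Y = \<Delta> c\<close>, the comultiplication of \<open>(x - \<epsilon>(x) 1) c\<close> is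
  \<open>\<Delta>(x) Y - \<epsilon>(x) Y\<close>.  Inserting \<open>(x \<otimes> 1) Y\<close> splits it into
  \<open>(x \<otimes> 1) Y - \<epsilon>(x) Y = ((x - \<epsilon>(x) 1) \<otimes> 1) Y\<close>, which lies in \<open>(I + k1)\<^sup>+ C \<otimes> C\<close>,
  and the difference \<open>\<Delta>(x) Y - (x \<otimes> 1) Y\<close> of \<open>tensor_act_mod_right\<close>.\<close>

lemma coideal_generated_coideal:
  assumes "left_coideal K H I"
  shows "coideal K C (generated_coideal I)"
proof -
  have I: "submodule I K H" and \<Delta>I: "comult H ` I \<subseteq> tensor_subspace K H H (carrier H) I"
    using assms by (auto simp: left_coideal_def)
  have I_sub: "I \<subseteq> carrier H" by (rule A.submoduleE(1)[OF I])
  let ?J = "generated_coideal I"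
  let ?N1 = "tensor_subspace K C C ?J (carrier C)"
  let ?N2 = "tensor_subspace K C C (carrier C) ?J"
  let ?N = "?N1 <+>\<^bsub>CC\<^esub> ?N2"
  have J: "submodule ?J K C" by (rule generated_coideal_submodule[OF I])
  note J_sub = V.submoduleE(1)[OF J]
  have N1: "submodule ?N1 K CC" and N2: "submodule ?N2 K CC"
    by (rule tensor_subspace_submodule[OF V.module_axioms V.module_axioms]; use J_sub in simp)+
  have N: "submodule ?N K CC" by (rule submodule_set_add[OF TV.tensor_module N1 N2])
  have comult_mem: "\<Delta> (act (reduced x) c) \<in> ?N" if x: "x \<in> I" and c: "c \<in> carrier C" for x c
  proof -
    have xH: "x \<in> carrier H" using x I_sub by blast
    let ?Y = "\<Delta> c"
    have Y: "?Y \<in> carrier CC" by (rule linear_map_closed[OF comult_linear c])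
    let ?F = "tensor_act K C act (comult H x) ?Y"
    have F: "?F \<in> carrier CC"
      by (rule linear_map_closed[OF tensor_act_linear[OF Y] linear_map_closed[OF comult_linear_H xH]])
    have G: "act2 x \<one>\<^bsub>H\<^esub> ?Y \<in> carrier CC"
      by (rule linear_map_closed[OF act2_linear[OF xH one_closed] Y])
    have "?F \<ominus>\<^bsub>CC\<^esub> act2 x \<one>\<^bsub>H\<^esub> ?Y \<in> ?N2"
      using tensor_act_mod_right[OF I _ Y, of "comult H x"] \<Delta>I x
      by (simp add: counit_right[OF xH] image_subset_iff)
    moreover have "act2 (reduced x) \<one>\<^bsub>H\<^esub> ?Y \<in> ?N1"
    proof (rule TV.linear_map_mem_if_pure[OF TV.tensor_module
            act2_linear[OF reduced_closed[OF xH] one_closed] N1 _ Y])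
      fix a b assume "a \<in> carrier C" "b \<in> carrier C"
      then show "act2 (reduced x) \<one>\<^bsub>H\<^esub> (pure_tensor K C C a b) \<in> ?N1"
        using xH x by (simp add: act2_pure reduced_closed one_closed pure_mem_tensor_subspace
            act_closed act_reduced_mem_generated[OF I])
    qed
    ultimately have mem: "act2 (reduced x) \<one>\<^bsub>H\<^esub> ?Y \<oplus>\<^bsub>CC\<^esub> (?F \<ominus>\<^bsub>CC\<^esub> act2 x \<one>\<^bsub>H\<^esub> ?Y) \<in> ?N"
      by (intro mem_set_addI)
    interpret CC: module K CC by (rule TV.tensor_module)
    have eY: "\<epsilon> x \<odot>\<^bsub>CC\<^esub> ?Y \<in> carrier CC" using counit_closed[OF xH] Y by simp
    have "\<Delta> (act (reduced x) c) = \<Delta> (act x c) \<ominus>\<^bsub>CC\<^esub> \<epsilon> x \<odot>\<^bsub>CC\<^esub> \<Delta> (act \<one>\<^bsub>H\<^esub> c)"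
      by (rule linear_map_reduced[OF TV.tensor_module linear_map_comp[OF \<mu>_left[OF c] comult_linear] xH])
    also have "\<dots> = ?F \<ominus>\<^bsub>CC\<^esub> \<epsilon> x \<odot>\<^bsub>CC\<^esub> ?Y"
      using xH c by (simp add: comult_act act_one)
    also have "\<dots> = (act2 x \<one>\<^bsub>H\<^esub> ?Y \<ominus>\<^bsub>CC\<^esub> \<epsilon> x \<odot>\<^bsub>CC\<^esub> ?Y) \<oplus>\<^bsub>CC\<^esub> (?F \<ominus>\<^bsub>CC\<^esub> act2 x \<one>\<^bsub>H\<^esub> ?Y)"
    proof -
      have "(g \<ominus>\<^bsub>CC\<^esub> e) \<oplus>\<^bsub>CC\<^esub> (f \<ominus>\<^bsub>CC\<^esub> g) = f \<ominus>\<^bsub>CC\<^esub> e"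
        if "f \<in> carrier CC" "g \<in> carrier CC" "e \<in> carrier CC" for f g e
      proof -
        have "(g \<ominus>\<^bsub>CC\<^esub> e) \<oplus>\<^bsub>CC\<^esub> (f \<ominus>\<^bsub>CC\<^esub> g) = (f \<ominus>\<^bsub>CC\<^esub> e) \<oplus>\<^bsub>CC\<^esub> (g \<oplus>\<^bsub>CC\<^esub> \<ominus>\<^bsub>CC\<^esub> g)"
          using that by (simp add: CC.M.minus_eq TV.T.a_ac del: CC.M.r_neg)
        then show ?thesis using that by (simp add: CC.M.r_neg)
      qed
      from this[OF F G eY] show ?thesis by simp
    qed
    also have "act2 x \<one>\<^bsub>H\<^esub> ?Y \<ominus>\<^bsub>CC\<^esub> \<epsilon> x \<odot>\<^bsub>CC\<^esub> ?Y = act2 (reduced x) \<one>\<^bsub>H\<^esub> ?Y"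
      using linear_map_reduced[OF TV.tensor_module act2_left[OF Y one_closed] xH]
      by (simp add: act2_one_one[OF Y])
    finally show ?thesis using mem by simp
  qed
  have counit_zero: "counit C (act (reduced x) c) = \<zero>\<^bsub>K\<^esub>" if "x \<in> I" "c \<in> carrier C" for x c
  proof -
    have "x \<in> carrier H" using that I_sub by blast
    then show ?thesis
      using that by (simp add: counit_act reduced_closed counit_reduced counit_closed_C)
  qed
  have closed: "act (reduced x) c \<in> carrier C" if "x \<in> I" "c \<in> carrier C" for x c
    using that I_sub by (auto intro!: act_closed reduced_closed)
  have "?J \<subseteq> {x \<in> carrier C. \<Delta> x \<in> ?N}"
    by (rule generated_coideal_minimal[OF I
          linear_preimage_submodule[OF V.module_axioms TV.tensor_module comult_linear N]])
      (use comult_mem closed in auto)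
  moreover have "?J \<subseteq> {x \<in> carrier C. counit C x = \<zero>\<^bsub>K\<^esub>}"
    by (rule generated_coideal_minimal[OF I
          linear_form_zeros_submodule[OF V.module_axioms counit_form]])
      (use counit_zero closed in auto)
  ultimately show ?thesis using J by (auto simp: coideal_def)
qed


section \<open>The Galois connection\<close>

lemma left_coideal_carrier: "left_coideal K H (carrier H)"
proof -
  have "carrier HH \<subseteq> tensor_subspace K H H (carrier H) (carrier H)"
    by (rule TA.carrier_subset_if_pure)
      (auto intro!: tensor_subspace_submodule pure_mem_tensor_subspace A.module_axioms)
  then show ?thesis
    using linear_map_closed[OF comult_linear_H] A.carrier_is_submodule
    by (auto simp: left_coideal_def)
qed

lemma left_coideal_span_Union:
  assumes "\<And>I. I \<in> F \<Longrightarrow> left_coideal K H I"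
  shows "left_coideal K H (lin_span K H (\<Union>F))" (is "left_coideal K H ?S")
proof -
  have sub: "\<Union>F \<subseteq> carrier H" using assms A.submoduleE(1) by (fastforce simp: left_coideal_def)
  have S: "submodule ?S K H" by (rule lin_span_submodule[OF A.module_axioms sub])
  let ?T = "tensor_subspace K H H (carrier H) ?S"
  have T: "submodule ?T K HH"
    by (rule tensor_subspace_submodule[OF A.module_axioms A.module_axioms subset_refl
          A.submoduleE(1)[OF S]])
  have "comult H x \<in> ?T" if "x \<in> I" "I \<in> F" for x I
  proof -
    have "comult H x \<in> tensor_subspace K H H (carrier H) I"
      using assms[OF that(2)] that(1) by (auto simp: left_coideal_def)
    moreover have "I \<subseteq> ?S" using that(2) lin_span_incl[of "\<Union>F" K H] by blast
    ultimately show ?thesis using tensor_subspace_mono[OF subset_refl] by blast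
  qed
  then have "?S \<subseteq> {x \<in> carrier H. comult H x \<in> ?T}"
    using sub
    by (intro lin_span_minimal
        linear_preimage_submodule[OF A.module_axioms TA.tensor_module comult_linear_H T]) auto
  then show ?thesis using S by (auto simp: left_coideal_def)
qed

lemma generated_coideal_span_Union:
  assumes F: "\<And>I. I \<in> F \<Longrightarrow> submodule I K H \<and> generated_coideal I \<subseteq> J"
    and J: "submodule J K C"
  shows "generated_coideal (lin_span K H (\<Union>F)) \<subseteq> J"
proof -
  have sub: "\<Union>F \<subseteq> carrier H" using F A.submoduleE(1) by blast
  have S: "submodule (lin_span K H (\<Union>F)) K H"
    by (rule lin_span_submodule[OF A.module_axioms sub])
  have "act (reduced x) c \<in> J" if "x \<in> lin_span K H (\<Union>F)" "c \<in> carrier C" for x c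
  proof -
    have "linear_map K H C (\<lambda>x. act (reduced x) c)"
      by (rule linear_map_comp[OF reduced_linear \<mu>_left[OF that(2)]])
    then have "lin_span K H (\<Union>F) \<subseteq> {x \<in> carrier H. act (reduced x) c \<in> J}"
      using sub act_reduced_mem_generated[OF _ _ that(2)] F
      by (intro lin_span_minimal linear_preimage_submodule[OF A.module_axioms V.module_axioms _ J])
        blast+
    then show ?thesis using that(1) by blast
  qed
  then show ?thesis
    by (rule generated_coideal_minimal[OF S J])
qed

text \<open>A quotient coalgebra remembers the coideal it was formed from, as its zero element.  This
  gives antisymmetry of the order on quotients, and lets a map on quotients be defined through
  the coideal.\<close>

lemma zero_quotient_coalgebra: "\<zero>\<^bsub>quotient_coalgebra K C J\<^esub> = J"
  by (simp add: quotient_coalgebra_def quotient_space_def module.defs coalgebra.defs)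

lemma quot_ge_iff:
  "quot_ge K C (quotient_coalgebra K C J1) (quotient_coalgebra K C J2) \<longleftrightarrow>
    coideal K C J1 \<and> coideal K C J2 \<and> J1 \<subseteq> J2"
  unfolding quot_ge_def by (metis zero_quotient_coalgebra)

lemma coideal_zero: "coideal K C {\<zero>\<^bsub>C\<^esub>}"
proof -
  have "submodule {\<zero>\<^bsub>C\<^esub>} K C" by (rule V.submoduleI) auto
  moreover have "\<Delta> \<zero>\<^bsub>C\<^esub> = \<zero>\<^bsub>CC\<^esub>"
    by (rule linear_map_zero[OF V.module_axioms TV.tensor_module comult_linear])
  moreover have "\<zero>\<^bsub>CC\<^esub> \<in> tensor_subspace K C C {\<zero>\<^bsub>C\<^esub>} (carrier C) <+>\<^bsub>CC\<^esub>
      tensor_subspace K C C (carrier C) {\<zero>\<^bsub>C\<^esub>}"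
    by (intro submodule_zero[OF TV.tensor_module] submodule_set_add[OF TV.tensor_module]
        tensor_subspace_submodule V.module_axioms) auto
  moreover have "counit C \<zero>\<^bsub>C\<^esub> = \<zero>\<^bsub>K\<^esub>"
    using submodule_zero[OF V.module_axioms linear_form_zeros_submodule[OF V.module_axioms counit_form]]
    by simp
  ultimately show ?thesis by (simp add: coideal_def)
qed

text \<open>Since \<open>1 \<in> H\<close>, the quotient \<open>C\<^sup>H\<close> is the case \<open>I = H\<close> of the construction.  Hence
  \<open>H\<^sup>+ C\<close> is a coideal, and by monotonicity it contains \<open>(I + k1)\<^sup>+ C\<close> for every \<open>I\<close>.\<close>

lemma coinvariant_quotient_eq:
  "coinvariant_quotient K H C act = quotient_coalgebra K C (generated_coideal (carrier H))"
proof -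
  have "plus_scalars K H (carrier H) = carrier H"
  proof
    show "carrier H \<subseteq> plus_scalars K H (carrier H)"
    proof
      fix h assume h: "h \<in> carrier H"
      have "h \<oplus>\<^bsub>H\<^esub> \<zero>\<^bsub>K\<^esub> \<odot>\<^bsub>H\<^esub> \<one>\<^bsub>H\<^esub> \<in> plus_scalars K H (carrier H)"
        unfolding plus_scalars_def by (rule mem_set_addI) (use h in auto)
      then show "h \<in> plus_scalars K H (carrier H)" using h one_closed by simp
    qed
  qed (auto simp: plus_scalars_def set_add_def' one_closed)
  then show ?thesis by (simp add: coinvariant_quotient_def generated_coideal_def)
qed

lemma Quot_poset_carrier:
  "carrier (Quot_poset K H C act) =
    quotient_coalgebra K C ` {J. coideal K C J \<and> J \<subseteq> generated_coideal (carrier H)}"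
proof -
  have "{\<zero>\<^bsub>C\<^esub>} \<subseteq> J" if "coideal K C J" for J
    using submodule_zero[OF V.module_axioms] that by (simp add: coideal_def)
  then show ?thesis
    using coideal_generated_coideal[OF left_coideal_carrier] coideal_zero
    by (auto simp: Quot_poset_def Quot_def coinvariant_quotient_eq quot_ge_iff)
qed

lemma Quot_poset_le:
  "quotient_coalgebra K C J1 \<sqsubseteq>\<^bsub>Quot_poset K H C act\<^esub> quotient_coalgebra K C J2 \<longleftrightarrow>
    coideal K C J1 \<and> coideal K C J2 \<and> J2 \<subseteq> J1"
  by (auto simp: Quot_poset_def quot_ge_iff)

lemma partial_order_Quot_poset: "partial_order (Quot_poset K H C act)"
proof -
  have eq: "eq (Quot_poset K H C act) = (=)" by (simp add: Quot_poset_def)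
  show ?thesis
    by unfold_locales
      (auto simp: eq Quot_poset_carrier Quot_poset_le intro: arg_cong[where f = "quotient_coalgebra K C"])
qed

lemma partial_order_coId_poset: "partial_order (coId_poset K H)"
  by unfold_locales (auto simp: coId_poset_def)

text \<open>The name is justified by \<open>left_coideal_largest\<close>, \<open>generated_coideal_largest\<close> and
  \<open>subset_largest\<close>: this sum is the greatest left coideal \<open>I\<close> with \<open>(I + k1)\<^sup>+ C \<subseteq> J\<close>.\<close>

definition largest_left_coideal :: "'c set \<Rightarrow> 'h set"
  where "largest_left_coideal J =
    lin_span K H (\<Union>{I. left_coideal K H I \<and> generated_coideal I \<subseteq> J})"

lemma left_coideal_largest: "left_coideal K H (largest_left_coideal J)"
  unfolding largest_left_coideal_def by (rule left_coideal_span_Union) blast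

lemma generated_coideal_largest:
  "submodule J K C \<Longrightarrow> generated_coideal (largest_left_coideal J) \<subseteq> J"
  unfolding largest_left_coideal_def
  by (rule generated_coideal_span_Union) (auto simp: left_coideal_def)

lemma subset_largest:
  "left_coideal K H I \<Longrightarrow> generated_coideal I \<subseteq> J \<Longrightarrow> I \<subseteq> largest_left_coideal J"
  unfolding largest_left_coideal_def by (rule subset_trans[OF _ lin_span_incl]) blast

lemma galois_connection_coideal_quotient:
  "antitone_galois_connection (coId_poset K H) (Quot_poset K H C act)
    (coideal_quotient K H C act) (\<lambda>Q. largest_left_coideal \<zero>\<^bsub>Q\<^esub>)"
proof -
  have f: "coideal_quotient K H C act I = quotient_coalgebra K C (generated_coideal I)" for I
    by (simp add: coideal_quotient_def generated_coideal_def)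
  have sub: "submodule I K H" if "left_coideal K H I" for I
    using that by (simp add: left_coideal_def)
  have mono: "generated_coideal I \<subseteq> generated_coideal I'"
    if "left_coideal K H I" "left_coideal K H I'" "I \<subseteq> I'" for I I'
    using generated_coideal_mono that sub by blast
  have le_carrier: "generated_coideal I \<subseteq> generated_coideal (carrier H)"
    if "left_coideal K H I" for I
    using that mono[OF that left_coideal_carrier] A.submoduleE(1)[OF sub] by blast
  have anti: "largest_left_coideal J1 \<subseteq> largest_left_coideal J2"
    if "coideal K C J1" "J1 \<subseteq> J2" for J1 J2
    using that generated_coideal_largest[of J1]
    by (intro subset_largest left_coideal_largest) (auto simp: coideal_def)
  have closure: "generated_coideal (largest_left_coideal J) \<subseteq> J" if "coideal K C J" for J
    using that generated_coideal_largest by (simp add: coideal_def)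
  show ?thesis
    unfolding antitone_galois_connection_def
    using partial_order_coId_poset partial_order_Quot_poset
    by (auto simp: coId_poset_def Quot_poset_carrier f Quot_poset_le zero_quotient_coalgebra
        left_coideal_largest coideal_generated_coideal
        intro: subsetD[OF mono] subsetD[OF le_carrier] subsetD[OF anti] subsetD[OF subset_largest]
          subsetD[OF closure])
qed

end

theorem proposition4p5p4:
  fixes K :: "('k, 'm) ring_scheme"
    and H :: "('k, 'h, 'n) coalgebra_scheme"
    and C :: "('k, 'c, 'p) coalgebra_scheme"
    and act :: "'h \<Rightarrow> 'c \<Rightarrow> 'c"
  assumes "field K"
    and "hopf_algebra K H"
    and "left_module_coalgebra K H C act"
  shows "\<exists>\<psi>. antitone_galois_connection (coId_poset K H) (Quot_poset K H C act)
    (coideal_quotient K H C act) \<psi>"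
proof -
  interpret bialgebra_module_coalgebra K H C act
    using assms(2,3) by (simp add: bialgebra_module_coalgebra_def hopf_algebra_def)
  show ?thesis using galois_connection_coideal_quotient by blast
qed

end
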